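(* For a stationary viscous shock profile $(\bar\rho,\bar u)$ of one-dimensional isentropic gas dynamics, the one-dimensional pseudo-Lagrangian Evans function $D_{\mathrm{pL}}(\lambda)$ agrees with (i.e., is a constant multiple of) the one-dimensional Lagrangian Evans function $D_{\mathrm L}(\lambda)$ (both defined in the context).
   Context: **Profile.** The Eulerian equations are $\rho_t+(\rho u)_x=0$, $(\rho u)_t+(\rho u^2+p(\rho))_x=u_{xx}$, with $p(\rho)=a\rho^\gamma$, $a,\gamma>0$. $(\bar\rho,\bar u)(x)$ is a steady solution with limits $(\rho_\pm,u_\pm)$ as $x\to\pm\infty$, so $\bar\rho\bar u\equiv m$ is constant; without loss of generality $m=1$ and $\rho_-=1$. Set $y(x)=\int_0^x\bar\rho(z)\,dz$, so that $dy/dx=\bar\rho$ and $y(0)=0$. The corresponding Lagrangian profile is $\bar\tau(y(x))=1/\bar\rho(x)$, $\bar w(y(x))=\bar u(x)$, a traveling wave of speed $s=-m=-1$ of $\tau_t-w_y=0$, $w_t+P(\tau)_y=(w_y/\tau)_y$, where $P$ is the pressure as a function of $\tau=1/\rho$. **Eulerian Evans system.** The eigenvalue problem is $\lambda\rho+(\bar\rho u+\rho\bar u)'=0$, $\lambda(\bar\rho u+\rho\bar u)+(\rho\bar u^2+2u+p'(\bar\rho)\rho)'=u''$. With $\beta=(\bar u^2+p'(\bar\rho))/\bar u$ and $W=(f_1,f_2,u)^T$, $f_1=-\rho\bar u-\bar\rho u$, $f_2=u'-2u-\beta\bar u\rho$, it is written as $dW/dx=\mathbf{A}(x;\lambda)W$,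 $$\mathbf{A}=\begin{pmatrix}-\lambda/\bar u&0&-\lambda\bar\rho/\bar u\\-\lambda&0&0\\-\beta&1&2-\beta\bar\rho\end{pmatrix}.$$ **Pseudo-Lagrangian Evans system.** This is obtained from the Eulerian Evans system by the change of independent variable $dy/dx=\bar\rho(x)$: $dY/dy=\mathbf{B}^{\mathrm{pL}}(y;\lambda)Y$, where $\mathbf{B}^{\mathrm{pL}}(y(x);\lambda)=(dx/dy)\mathbf{A}(x;\lambda)=\bar\rho(x)^{-1}\mathbf{A}(x;\lambda)$. **Lagrangian Evans system.** With $'=d/dy$ and $P'(\bar\tau)$ standing for $a\gamma\bar\tau^{-\gamma-1}$, the eigenvalue problem is $\lambda\tau+\tau'-w'=0$, $\lambda w+w'-(P'(\bar\tau)\tau)'=\left(\frac{w'}{\bar\tau}-\frac{\bar w'\tau}{\bar\tau^2}\right)'$. With $Z=(\tau,w,w')^T$ and $\alpha=P'(\bar\tau)-\bar w'/\bar\tau^2$, the first-order system used is $dZ/dy=\mathbf{B}^{\mathrm L}(y;\lambda)Z$, $$\mathbf{B}^{\mathrm L}=\begin{pmatrix}-\lambda&0&1\\0&0&1\\ \lambda\alpha\bar\tau&\lambda\bar\tau&\bar\tau(1-\alpha)\end{pmatrix}.$$ **Evans functions.** Let $\mathbf{M}$ denote $\mathbf{B}^{\mathrm{pL}}$ or $\mathbf{B}^{\mathrm L}$, with limits $\mathbf{M}_\pm(\lambda)$ as $y\to\pm\infty$. On the region $\operatorname{Re}\lambda\ge0$, $\lambda\ne0$, the Evans function is $D(\lambda)=\det(Z_1,Z_2,Z_3)|_{y=0}$,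 where $\{Z_1,Z_2\}$ and $\{Z_3\}$ are bases of the solutions of $Z_y=\mathbf{M}Z$ decaying at $+\infty$ and at $-\infty$ respectively, asymptotic to eigenmodes $e^{\nu_jy}U_j$ of the stable (negative real part) subspace of $\mathbf{M}_+$, respectively the unstable (positive real part) subspace of $\mathbf{M}_-$. The $U_j(\lambda)$ are the columns of solutions $S$ of Kato's ODE $dS/d\lambda=(d\mathcal{Q}/d\lambda)S$, with $\mathcal{Q}(\lambda)$ the projection onto the stable (unstable) subspace of $\mathbf{M}_+$ ($\mathbf{M}_-$). This determines $D$ up to a constant factor, independent of $\lambda$. $D_{\mathrm{pL}}$ and $D_{\mathrm L}$ are the Evans functions for $\mathbf{M}=\mathbf{B}^{\mathrm{pL}}$ and $\mathbf{M}=\mathbf{B}^{\mathrm L}$ respectively.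
   Formalization: The third row of B^L is corrected to (λατ̄ − τ̄α', λτ̄, τ̄(1−α) + τ̄'/τ̄), the true first-order form of the stated Lagrangian eigenvalue problem in (τ,w,w'); the printed matrix governs antiderivatives of (τ,w), and for it the claim is false. *)

theory Defs
  imports "HOL-Analysis.Analysis"
begin

subsection \<open>The shock profile\<close>

definition pressure :: "real \<Rightarrow> real \<Rightarrow> real \<Rightarrow> real" where
  "pressure a \<gamma> r = a * r powr \<gamma>"

text \<open>
  Steady solutions of
  \<open>\<rho>\<^sub>t + (\<rho> u)\<^sub>x = 0\<close>, \<open>(\<rho> u)\<^sub>t + (\<rho> u\<^sup>2 + p(\<rho>))\<^sub>x = u\<^sub>x\<^sub>x\<close>
  with distinct end states, normalized to mass flux \<open>m = 1\<close> and \<open>\<rho>\<^sub>- = 1\<close>.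
  The continuity equation is contained in \<open>\<rho> u = m = 1\<close>, which also keeps
  \<open>\<rho>\<^sub>+\<close> away from vacuum.
\<close>

definition shock_profile :: "real \<Rightarrow> real \<Rightarrow> (real \<Rightarrow> real) \<Rightarrow> (real \<Rightarrow> real) \<Rightarrow> bool" where
  "shock_profile a \<gamma> \<rho> u \<longleftrightarrow>
     (\<forall>x. \<rho> x > 0 \<and> \<rho> x * u x = 1 \<and>
        \<rho> differentiable (at x) \<and> u differentiable (at x) \<and> deriv u differentiable (at x) \<and>
        deriv (\<lambda>z. \<rho> z * (u z)\<^sup>2 + pressure a \<gamma> (\<rho> z)) x = deriv (deriv u) x) \<and>
     (\<exists>u\<^sub>m \<rho>\<^sub>p u\<^sub>p. (\<rho> \<longlongrightarrow> 1) at_bot \<and> (u \<longlongrightarrow> u\<^sub>m) at_bot \<and>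
        (\<rho> \<longlongrightarrow> \<rho>\<^sub>p) at_top \<and> (u \<longlongrightarrow> u\<^sub>p) at_top \<and> \<rho>\<^sub>p \<noteq> 1)"

text \<open>The map \<open>x \<mapsto> y(x)\<close>; it is a bijection of the real line for a shock profile.\<close>

definition lag_coord :: "(real \<Rightarrow> real) \<Rightarrow> real \<Rightarrow> real" where
  "lag_coord \<rho> x = (LBINT z=0..ereal x. \<rho> z)"

definition eul_coord :: "(real \<Rightarrow> real) \<Rightarrow> real \<Rightarrow> real" where
  "eul_coord \<rho> = inv (lag_coord \<rho>)"

definition tau_bar :: "(real \<Rightarrow> real) \<Rightarrow> real \<Rightarrow> real" where
  "tau_bar \<rho> y = 1 / \<rho> (eul_coord \<rho> y)"

definition w_bar :: "(real \<Rightarrow> real) \<Rightarrow> (real \<Rightarrow> real) \<Rightarrow> real \<Rightarrow> real" where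
  "w_bar \<rho> u y = u (eul_coord \<rho> y)"

subsection \<open>The Evans systems\<close>

text \<open>
  The spectral parameter, usually called lambda, is written \<open>\<mu>\<close> because that letter is the
  abstraction symbol here.
\<close>

definition eul_beta :: "real \<Rightarrow> real \<Rightarrow> (real \<Rightarrow> real) \<Rightarrow> (real \<Rightarrow> real) \<Rightarrow> real \<Rightarrow> real" where
  "eul_beta a \<gamma> \<rho> u x = ((u x)\<^sup>2 + deriv (pressure a \<gamma>) (\<rho> x)) / u x"

definition eulerian_matrix ::
  "real \<Rightarrow> real \<Rightarrow> (real \<Rightarrow> real) \<Rightarrow> (real \<Rightarrow> real) \<Rightarrow> real \<Rightarrow> complex \<Rightarrow> complex^3^3" where
  "eulerian_matrix a \<gamma> \<rho> u x \<mu> =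
     (let r = complex_of_real (\<rho> x); v = complex_of_real (u x);
          \<beta> = complex_of_real (eul_beta a \<gamma> \<rho> u x)
      in vector [vector [- \<mu> / v, 0, - \<mu> * r / v],
                 vector [- \<mu>, 0, 0],
                 vector [- \<beta>, 1, 2 - \<beta> * r]])"

definition pseudo_lagrangian_matrix ::
  "real \<Rightarrow> real \<Rightarrow> (real \<Rightarrow> real) \<Rightarrow> (real \<Rightarrow> real) \<Rightarrow> real \<Rightarrow> complex \<Rightarrow> complex^3^3" where
  "pseudo_lagrangian_matrix a \<gamma> \<rho> u y \<mu> =
     (1 / \<rho> (eul_coord \<rho> y)) *\<^sub>R eulerian_matrix a \<gamma> \<rho> u (eul_coord \<rho> y) \<mu>"

text \<open>
  \<open>P'(\<tau>)\<close> stands for \<open>a \<gamma> \<tau> powr (-\<gamma>-1)\<close>, i.e. for minus the derivative of the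
  pressure \<open>a \<tau> powr (-\<gamma>)\<close> with respect to \<open>\<tau>\<close>.
\<close>

definition lag_alpha ::
  "real \<Rightarrow> real \<Rightarrow> (real \<Rightarrow> real) \<Rightarrow> (real \<Rightarrow> real) \<Rightarrow> real \<Rightarrow> real" where
  "lag_alpha a \<gamma> \<tau>\<^sub>b w\<^sub>b y = a * \<gamma> * \<tau>\<^sub>b y powr (- \<gamma> - 1) - deriv w\<^sub>b y / (\<tau>\<^sub>b y)\<^sup>2"

text \<open>
  The first-order system in \<open>Z = (\<tau>, w, w')\<close> of the Lagrangian eigenvalue problem
  (see \<open>lagrangian_system_iff_eigenproblem\<close> below).  Writing the second equation as
  \<open>(w' / \<tau>\<^sub>b)' = \<mu> w + w' - (\<alpha> \<tau>)'\<close> and using \<open>\<tau>' = w' - \<mu> \<tau>\<close> gives the third row.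
  The two terms with a derivative of a coefficient, \<open>- \<tau>\<^sub>b \<alpha>'\<close> and \<open>\<tau>\<^sub>b' / \<tau>\<^sub>b\<close>, vanish as
  \<open>y \<rightarrow> \<plusminus>\<infinity>\<close>.  The matrix without them has third row
  \<open>(\<mu> \<alpha> \<tau>\<^sub>b, \<mu> \<tau>\<^sub>b, \<tau>\<^sub>b (1 - \<alpha>))\<close> and governs the antiderivatives of \<open>(\<tau>, w)\<close> instead;
  its Evans function has a nonzero limit at \<open>\<mu> = 0\<close>, whereas the pseudo-Lagrangian one
  tends to zero there, so the two are not constant multiples of each other.
\<close>

definition lagrangian_matrix ::
  "real \<Rightarrow> real \<Rightarrow> (real \<Rightarrow> real) \<Rightarrow> (real \<Rightarrow> real) \<Rightarrow> real \<Rightarrow> complex \<Rightarrow> complex^3^3" where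
  "lagrangian_matrix a \<gamma> \<tau>\<^sub>b w\<^sub>b y \<mu> =
     (let t = complex_of_real (\<tau>\<^sub>b y); t' = complex_of_real (deriv \<tau>\<^sub>b y);
          \<alpha> = complex_of_real (lag_alpha a \<gamma> \<tau>\<^sub>b w\<^sub>b y);
          \<alpha>' = complex_of_real (deriv (lag_alpha a \<gamma> \<tau>\<^sub>b w\<^sub>b) y)
      in vector [vector [- \<mu>, 0, 1],
                 vector [0, 0, 1],
                 vector [\<mu> * \<alpha> * t - t * \<alpha>', \<mu> * t, t * (1 - \<alpha>) + t' / t]])"

text \<open>
  The Lagrangian eigenvalue problem \<open>\<mu> \<tau> + \<tau>' - w' = 0\<close>,
  \<open>\<mu> w + w' - (P'(\<tau>\<^sub>b) \<tau>)' = (w' / \<tau>\<^sub>b - w\<^sub>b' \<tau> / \<tau>\<^sub>b\<^sup>2)'\<close>, with \<open>q = w'\<close>.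
\<close>

definition lagrangian_eigenproblem ::
  "real \<Rightarrow> real \<Rightarrow> (real \<Rightarrow> real) \<Rightarrow> (real \<Rightarrow> real) \<Rightarrow> complex \<Rightarrow>
   (real \<Rightarrow> complex) \<Rightarrow> (real \<Rightarrow> complex) \<Rightarrow> (real \<Rightarrow> complex) \<Rightarrow> bool" where
  "lagrangian_eigenproblem a \<gamma> \<tau>\<^sub>b w\<^sub>b \<mu> \<tau> w q \<longleftrightarrow>
     (\<forall>y. (w has_vector_derivative q y) (at y) \<and>
        (\<exists>\<tau>'. (\<tau> has_vector_derivative \<tau>') (at y) \<and> \<mu> * \<tau> y + \<tau>' - q y = 0) \<and>
        (\<exists>F G. ((\<lambda>z. complex_of_real (a * \<gamma> * \<tau>\<^sub>b z powr (- \<gamma> - 1)) * \<tau> z)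
                   has_vector_derivative F) (at y) \<and>
               ((\<lambda>z. q z / complex_of_real (\<tau>\<^sub>b z)
                     - complex_of_real (deriv w\<^sub>b z) * \<tau> z / (complex_of_real (\<tau>\<^sub>b z))\<^sup>2)
                   has_vector_derivative G) (at y) \<and>
               \<mu> * w y + q y - F = G))"

lemma has_vector_derivative_vec3_iff:
  fixes f g h :: "real \<Rightarrow> complex"
  shows "((\<lambda>y. vector [f y, g y, h y] :: complex^3) has_vector_derivative vector [f', g', h']) (at y)
    \<longleftrightarrow> (f has_vector_derivative f') (at y) \<and> (g has_vector_derivative g') (at y) \<and>
        (h has_vector_derivative h') (at y)"
proof -
  have D: "(Z has_vector_derivative Z') (at y) \<longleftrightarrow>
      (\<forall>i. ((\<lambda>y. Z y $ i) has_vector_derivative Z' $ i) (at y))"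
    for Z :: "real \<Rightarrow> complex^3" and Z'
  proof
    assume "(Z has_vector_derivative Z') (at y)"
    then show "\<forall>i. ((\<lambda>y. Z y $ i) has_vector_derivative Z' $ i) (at y)"
      using bounded_linear.has_vector_derivative[OF bounded_linear_vec_nth] by blast
  next
    assume A: "\<forall>i. ((\<lambda>y. Z y $ i) has_vector_derivative Z' $ i) (at y)"
    have "(Z has_derivative (\<lambda>x. x *\<^sub>R Z')) (at y)"
      unfolding has_derivative_within
    proof (intro conjI vec_tendstoI)
      show "bounded_linear (\<lambda>x. x *\<^sub>R Z')" by (rule bounded_linear_scaleR_left)
      fix i
      show "((\<lambda>x. ((1 / norm (x - y)) *\<^sub>R (Z x - (Z y + (x - y) *\<^sub>R Z'))) $ i) \<longlongrightarrow> 0 $ i) (at y)"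
        using A[rule_format, of i]
        by (simp add: has_vector_derivative_def has_derivative_within)
    qed
    then show "(Z has_vector_derivative Z') (at y)" by (simp add: has_vector_derivative_def)
  qed
  show ?thesis unfolding D by (simp add: forall_3)
qed

text \<open>The hypotheses on \<open>\<tau>\<^sub>b\<close> and \<open>w\<^sub>b\<close> hold for \<open>tau_bar \<rho>\<close> and \<open>w_bar \<rho> u\<close>.\<close>

lemma lagrangian_system_iff_eigenproblem:
  fixes \<tau> w q :: "real \<Rightarrow> complex"
  assumes pos: "\<And>y. \<tau>\<^sub>b y > 0"
    and dt: "\<And>y. \<tau>\<^sub>b differentiable (at y)"
    and dw: "\<And>y. deriv w\<^sub>b differentiable (at y)"
  shows "(\<forall>y. ((\<lambda>z. vector [\<tau> z, w z, q z]) has_vector_derivative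
               lagrangian_matrix a \<gamma> \<tau>\<^sub>b w\<^sub>b y \<mu> *v vector [\<tau> y, w y, q y]) (at y))
         \<longleftrightarrow> lagrangian_eigenproblem a \<gamma> \<tau>\<^sub>b w\<^sub>b \<mu> \<tau> w q"
proof -
  define P where "P y = complex_of_real (a * \<gamma> * \<tau>\<^sub>b y powr (- \<gamma> - 1))" for y
  define P' where "P' y = complex_of_real (a * \<gamma> * ((- \<gamma> - 1) * \<tau>\<^sub>b y powr (- \<gamma> - 2) * deriv \<tau>\<^sub>b y))" for y
  define t where "t y = complex_of_real (\<tau>\<^sub>b y)" for y
  define t' where "t' y = complex_of_real (deriv \<tau>\<^sub>b y)" for y
  define v where "v y = complex_of_real (deriv w\<^sub>b y)" for y
  define v' where "v' y = complex_of_real (deriv (deriv w\<^sub>b) y)" for y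
  define A where "A y = complex_of_real (lag_alpha a \<gamma> \<tau>\<^sub>b w\<^sub>b y)" for y
  define A' where "A' y = complex_of_real (deriv (lag_alpha a \<gamma> \<tau>\<^sub>b w\<^sub>b) y)" for y
  have Dt: "(\<tau>\<^sub>b has_real_derivative deriv \<tau>\<^sub>b y) (at y)" for y
    using dt DERIV_deriv_iff_real_differentiable by blast
  have Dv: "(deriv w\<^sub>b has_real_derivative deriv (deriv w\<^sub>b) y) (at y)" for y
    using dw DERIV_deriv_iff_real_differentiable by blast
  have DP: "((\<lambda>y. a * \<gamma> * \<tau>\<^sub>b y powr (- \<gamma> - 1)) has_real_derivative
              a * \<gamma> * ((- \<gamma> - 1) * \<tau>\<^sub>b y powr (- \<gamma> - 2) * deriv \<tau>\<^sub>b y)) (at y)" for y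
  proof -
    have "((\<lambda>y. \<tau>\<^sub>b y powr (- \<gamma> - 1)) has_real_derivative
            (- \<gamma> - 1) * \<tau>\<^sub>b y powr (- \<gamma> - 1 - 1) * deriv \<tau>\<^sub>b y) (at y)"
      using DERIV_fun_powr[OF Dt pos, of "- \<gamma> - 1" y] by (simp add: algebra_simps)
    from DERIV_cmult[OF this, of "a * \<gamma>"] show ?thesis by (simp add: algebra_simps)
  qed
  have "\<exists>d. (lag_alpha a \<gamma> \<tau>\<^sub>b w\<^sub>b has_real_derivative d) (at y)" for y
  proof -
    have "((\<lambda>y. (\<tau>\<^sub>b y)\<^sup>2) has_real_derivative 2 * \<tau>\<^sub>b y * deriv \<tau>\<^sub>b y) (at y)"
      using DERIV_power[OF Dt, of 2 y] by (simp add: algebra_simps)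
    from DERIV_diff[OF DP DERIV_divide[OF Dv this]] pos[of y]
    show ?thesis unfolding lag_alpha_def[abs_def] by auto
  qed
  then have DA: "(lag_alpha a \<gamma> \<tau>\<^sub>b w\<^sub>b has_real_derivative deriv (lag_alpha a \<gamma> \<tau>\<^sub>b w\<^sub>b) y) (at y)" for y
    using DERIV_deriv_iff_real_differentiable real_differentiable_def by metis
  have t0: "t y \<noteq> 0" for y using pos[of y] by (simp add: t_def)
  have cx: "((\<lambda>y. complex_of_real (f y)) has_vector_derivative complex_of_real d) (at y)"
    if "(f has_real_derivative d) (at y)" for f d y
    using that by (rule has_vector_derivative_of_real)
  have ct: "(t has_vector_derivative t' y) (at y)" for y
    unfolding t_def[abs_def] t'_def by (rule cx[OF Dt])
  have cA: "(A has_vector_derivative A' y) (at y)" for y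
    unfolding A_def[abs_def] A'_def by (rule cx[OF DA])
  have cP: "(P has_vector_derivative P' y) (at y)" for y
    unfolding P_def[abs_def] P'_def by (rule cx[OF DP])
  have PA: "P y = A y + v y / (t y)\<^sup>2" for y
    by (simp add: P_def A_def v_def t_def lag_alpha_def)
  have mult: "lagrangian_matrix a \<gamma> \<tau>\<^sub>b w\<^sub>b y \<mu> *v vector [\<tau> y, w y, q y] =
      vector [- \<mu> * \<tau> y + q y, q y,
        (\<mu> * A y * t y - t y * A' y) * \<tau> y + \<mu> * t y * w y + (t y * (1 - A y) + t' y / t y) * q y]" for y
    by (simp add: lagrangian_matrix_def Let_def vec_eq_iff forall_3 matrix_vector_mult_def sum_3
        A_def A'_def t_def t'_def)
  have main: "((\<tau> has_vector_derivative - \<mu> * \<tau> y + q y) (at y) \<and> (w has_vector_derivative q y) (at y) \<and>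
      (q has_vector_derivative (\<mu> * A y * t y - t y * A' y) * \<tau> y + \<mu> * t y * w y
            + (t y * (1 - A y) + t' y / t y) * q y) (at y)) \<longleftrightarrow>
     ((w has_vector_derivative q y) (at y) \<and>
        (\<exists>\<tau>'. (\<tau> has_vector_derivative \<tau>') (at y) \<and> \<mu> * \<tau> y + \<tau>' - q y = 0) \<and>
        (\<exists>F G. ((\<lambda>z. P z * \<tau> z) has_vector_derivative F) (at y) \<and>
               ((\<lambda>z. q z / t z - v z * \<tau> z / (t z)\<^sup>2) has_vector_derivative G) (at y) \<and>
               \<mu> * w y + q y - F = G))" (is "?l \<longleftrightarrow> ?r") for y
  proof
    assume l: ?l
    define \<tau>' where "\<tau>' = - \<mu> * \<tau> y + q y"
    define q' where "q' = (\<mu> * A y * t y - t y * A' y) * \<tau> y + \<mu> * t y * w y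
            + (t y * (1 - A y) + t' y / t y) * q y"
    have l1: "(\<tau> has_vector_derivative \<tau>') (at y)" and l2: "(w has_vector_derivative q y) (at y)"
      and l3: "(q has_vector_derivative q') (at y)" using l by (simp_all add: \<tau>'_def q'_def)
    have F: "((\<lambda>z. P z * \<tau> z) has_vector_derivative P y * \<tau>' + P' y * \<tau> y) (at y)"
      by (rule has_vector_derivative_mult[OF cP l1])
    have B: "((\<lambda>z. q z / t z) has_vector_derivative (q' * t y - q y * t' y) / (t y * t y)) (at y)"
    proof -
      have "((\<lambda>z. 1 / \<tau>\<^sub>b z) has_real_derivative - (deriv \<tau>\<^sub>b y / (\<tau>\<^sub>b y * \<tau>\<^sub>b y))) (at y)"
        using DERIV_divide[OF DERIV_const Dt, of y 1] pos[of y] by simp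
      from has_vector_derivative_mult[OF l3 cx[OF this]] t0[of y] show ?thesis
        by (simp add: t_def t'_def diff_divide_distrib algebra_simps)
    qed
    have C: "((\<lambda>z. A z * \<tau> z) has_vector_derivative A y * \<tau>' + A' y * \<tau> y) (at y)"
      by (rule has_vector_derivative_mult[OF cA l1])
    have G: "((\<lambda>z. q z / t z - v z * \<tau> z / (t z)\<^sup>2) has_vector_derivative
        (q' * t y - q y * t' y) / (t y * t y) + (A y * \<tau>' + A' y * \<tau> y) - (P y * \<tau>' + P' y * \<tau> y)) (at y)"
      using has_vector_derivative_diff[OF has_vector_derivative_add[OF B C] F]
      by (simp add: PA algebra_simps)
    have "\<mu> * w y + q y = (q' * t y - q y * t' y) / (t y * t y) + (A y * \<tau>' + A' y * \<tau> y)"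
      using t0[of y] by (simp add: q'_def \<tau>'_def field_simps)
    then have "\<mu> * w y + q y - (P y * \<tau>' + P' y * \<tau> y) =
       (q' * t y - q y * t' y) / (t y * t y) + (A y * \<tau>' + A' y * \<tau> y) - (P y * \<tau>' + P' y * \<tau> y)" by simp
    note e = this
    have "\<mu> * \<tau> y + \<tau>' - q y = 0" by (simp add: \<tau>'_def)
    with e F G l1 l2 show ?r by blast
  next
    assume r: ?r
    then obtain \<tau>' F G where l2: "(w has_vector_derivative q y) (at y)"
      and l1': "(\<tau> has_vector_derivative \<tau>') (at y)" and \<tau>': "\<mu> * \<tau> y + \<tau>' - q y = 0"
      and F: "((\<lambda>z. P z * \<tau> z) has_vector_derivative F) (at y)"
      and G: "((\<lambda>z. q z / t z - v z * \<tau> z / (t z)\<^sup>2) has_vector_derivative G) (at y)"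
      and e: "\<mu> * w y + q y - F = G"
      by blast
    have "\<tau>' = - \<mu> * \<tau> y + q y" using \<tau>' by (simp add: algebra_simps eq_neg_iff_add_eq_0)
    with l1' have l1: "(\<tau> has_vector_derivative - \<mu> * \<tau> y + q y) (at y)" by simp
    have C: "((\<lambda>z. A z * \<tau> z) has_vector_derivative A y * (- \<mu> * \<tau> y + q y) + A' y * \<tau> y) (at y)"
      by (rule has_vector_derivative_mult[OF cA l1])
    have "((\<lambda>z. t z * (q z / t z)) has_vector_derivative
        t y * (G + F - (A y * (- \<mu> * \<tau> y + q y) + A' y * \<tau> y)) + t' y * (q y / t y)) (at y)"
      by (rule has_vector_derivative_mult[OF ct])
        (use has_vector_derivative_diff[OF has_vector_derivative_add[OF G F] C] in
          \<open>simp add: PA algebra_simps\<close>)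
    then have "(q has_vector_derivative
        t y * (\<mu> * w y + q y - (A y * (- \<mu> * \<tau> y + q y) + A' y * \<tau> y)) + t' y * (q y / t y)) (at y)"
      using t0 e by (simp add: algebra_simps)
    then have "(q has_vector_derivative (\<mu> * A y * t y - t y * A' y) * \<tau> y + \<mu> * t y * w y
            + (t y * (1 - A y) + t' y / t y) * q y) (at y)"
      by (simp add: algebra_simps)
    with l1 l2 show ?l by blast
  qed
  show ?thesis
    unfolding mult has_vector_derivative_vec3_iff main lagrangian_eigenproblem_def
    by (simp add: P_def v_def t_def)
qed

subsection \<open>Stable and unstable subspaces, Kato bases\<close>

definition gen_eigenspace :: "complex^'n^'n \<Rightarrow> complex \<Rightarrow> (complex^'n) set" where
  "gen_eigenspace A \<nu> = {v. \<exists>k. (((*v) (A - mat \<nu>)) ^^ k) v = 0}"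

definition spectral_subspace ::
  "complex^'n^'n \<Rightarrow> (complex \<Rightarrow> bool) \<Rightarrow> (complex^'n) set" where
  "spectral_subspace A R = vec.span (\<Union>\<nu>\<in>Collect R. gen_eigenspace A \<nu>)"

definition spectral_projection ::
  "complex^'n^'n \<Rightarrow> (complex \<Rightarrow> bool) \<Rightarrow> complex^'n^'n \<Rightarrow> bool" where
  "spectral_projection A R Q \<longleftrightarrow>
     Q ** Q = Q \<and>
     range ((*v) Q) = spectral_subspace A R \<and>
     {v. Q *v v = 0} = spectral_subspace A (\<lambda>\<nu>. \<not> R \<nu>)"

definition stable :: "complex \<Rightarrow> bool" where "stable \<nu> \<longleftrightarrow> Re \<nu> < 0"

definition unstable :: "complex \<Rightarrow> bool" where "unstable \<nu> \<longleftrightarrow> Re \<nu> > 0"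

definition evans_region :: "complex set" where
  "evans_region = {\<mu>. Re \<mu> \<ge> 0 \<and> \<mu> \<noteq> 0}"

text \<open>
  The columns of \<open>S \<mu>\<close> form a basis of the spectral subspace of \<open>N \<mu>\<close>, and \<open>S\<close> solves
  Kato's equation \<open>dS/d\<mu> = (d\<Q>/d\<mu>) S\<close>.
\<close>

definition kato_basis ::
  "(complex \<Rightarrow> complex^3^3) \<Rightarrow> (complex \<Rightarrow> bool) \<Rightarrow> (complex \<Rightarrow> complex^'k^3) \<Rightarrow> bool" where
  "kato_basis N R S \<longleftrightarrow>
     (\<exists>Q Q'. \<forall>\<mu>\<in>evans_region.
        spectral_projection (N \<mu>) R (Q \<mu>) \<and>
        (\<forall>i j. ((\<lambda>l. Q l $ i $ j) has_field_derivative Q' \<mu> $ i $ j) (at \<mu> within evans_region)) \<and>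
        (\<forall>i j. ((\<lambda>l. S l $ i $ j) has_field_derivative (Q' \<mu> ** S \<mu>) $ i $ j)
                 (at \<mu> within evans_region)) \<and>
        bij_betw (\<lambda>c. S \<mu> *v c) UNIV (spectral_subspace (N \<mu>) R))"

subsection \<open>Evans functions\<close>

definition mat_exp :: "complex^'k^'k \<Rightarrow> complex^'k^'k" where
  "mat_exp A = (\<Sum>n. (1 / fact n) *\<^sub>R (((**) A ^^ n) (mat 1)))"

definition decaying_solutions ::
  "(real \<Rightarrow> complex^3^3) \<Rightarrow> real filter \<Rightarrow> (real \<Rightarrow> complex^3) set" where
  "decaying_solutions M F =
     {z. (\<forall>y. (z has_vector_derivative M y *v z y) (at y)) \<and> (z \<longlongrightarrow> 0) F}"

text \<open>
  The columns of \<open>Z\<close> form a basis of the solutions decaying along \<open>F\<close>, asymptotic to the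
  modes given by the columns of \<open>S\<close>.  Kato's equation transports the invariant subspace as a
  whole, so the columns of \<open>S\<close> need not be single eigenvectors.  With \<open>\<Lambda>\<close> the matrix of the
  limiting coefficient \<open>N\<close> in the basis \<open>S\<close>, the requirement \<open>Z(y) e\<^sup>-\<^sup>y\<^sup>\<Lambda> \<rightarrow> S\<close> says
  \<open>e\<^sup>-\<^sup>\<nu>\<^sup>y Z\<^sub>j(y) \<rightarrow> U\<^sub>j\<close> when the columns \<open>U\<^sub>j\<close> are eigenvectors, and it is
  invariant under a simultaneous change of basis \<open>(Z, S) \<mapsto> (Z C, S C)\<close>.
\<close>

definition decaying_basis ::
  "(real \<Rightarrow> complex^3^3) \<Rightarrow> complex^3^3 \<Rightarrow> real filter \<Rightarrow> complex^'k^3 \<Rightarrow>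
   (real \<Rightarrow> complex^'k^3) \<Rightarrow> bool" where
  "decaying_basis M N F S Z \<longleftrightarrow>
     bij_betw (\<lambda>c y. Z y *v c) UNIV (decaying_solutions M F) \<and>
     (\<exists>\<Lambda>. N ** S = S ** \<Lambda> \<and> ((\<lambda>y. Z y ** mat_exp (- y *\<^sub>R \<Lambda>)) \<longlongrightarrow> S) F)"

text \<open>
  \<open>D\<close> is an Evans function of \<open>Z' = M(y; \<mu>) Z\<close>; a relation, since Kato's equation
  determines \<open>D\<close> only up to a constant factor.
\<close>

definition evans_function ::
  "(real \<Rightarrow> complex \<Rightarrow> complex^3^3) \<Rightarrow> (complex \<Rightarrow> complex) \<Rightarrow> bool" where
  "evans_function M D \<longleftrightarrow>
     (\<exists>N\<^sub>p N\<^sub>m (S\<^sub>p :: complex \<Rightarrow> complex^2^3) (S\<^sub>m :: complex \<Rightarrow> complex^1^3).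
        kato_basis N\<^sub>p stable S\<^sub>p \<and> kato_basis N\<^sub>m unstable S\<^sub>m \<and>
        (\<forall>\<mu>\<in>evans_region.
           ((\<lambda>y. M y \<mu>) \<longlongrightarrow> N\<^sub>p \<mu>) at_top \<and> ((\<lambda>y. M y \<mu>) \<longlongrightarrow> N\<^sub>m \<mu>) at_bot \<and>
           (\<exists>Z\<^sub>p Z\<^sub>m.
              decaying_basis (\<lambda>y. M y \<mu>) (N\<^sub>p \<mu>) at_top (S\<^sub>p \<mu>) Z\<^sub>p \<and>
              decaying_basis (\<lambda>y. M y \<mu>) (N\<^sub>m \<mu>) at_bot (S\<^sub>m \<mu>) Z\<^sub>m \<and>
              D \<mu> = det (\<chi> i. vector [Z\<^sub>p 0 $ i $ 1, Z\<^sub>p 0 $ i $ 2, Z\<^sub>m 0 $ i $ 1] :: complex^3^3))))"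

end

theory Submission
  imports Defs
begin

text \<open>
  The Lagrangian and the pseudo-Lagrangian system are conjugate: the passage from Lagrangian to
  Eulerian perturbations at \<open>y\<close> is an invertible matrix \<open>T(y; \<mu>)\<close> with
  \<open>T' + T B\<^sup>L = B\<^sup>p\<^sup>L T\<close>.  It depends on \<open>\<mu>\<close> only through terms multiplied by the slope of the
  profile, so its limits \<open>T\<^sub>\<plusminus>\<close> do not depend on \<open>\<mu>\<close>, and its determinant is \<open>- 1 / \<tau>\<^sub>b\<^sup>2\<close>.
  Therefore \<open>T\<^sub>\<plusminus>\<close> carries Kato bases to Kato bases up to a constant right factor \<open>C\<^sub>\<plusminus>\<close>, and
  \<open>T\<close> carries the decaying solutions to decaying solutions.  The asymptotic normalization fixes
  the determinant of the resulting change of basis to be that of \<open>C\<^sub>\<plusminus>\<close>, which leaves the constant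
  \<open>- det C\<^sub>+ det C\<^sub>- / \<tau>\<^sub>b(0)\<^sup>2\<close> between the two Evans functions.
\<close>

subsection \<open>Complex matrices\<close>

text \<open>In finite dimension a bilinear map is bounded; matrix products thereby inherit limits,
  product rules and termwise action on series.\<close>

lemma bounded_bilinear_matrix_mult:
  "bounded_bilinear ((**) :: complex^'n^'m \<Rightarrow> complex^'k^'n \<Rightarrow> complex^'k^'m)"
  by (simp flip: bilinear_conv_bounded_bilinear add: bilinear_def linear_iff vec_eq_iff
      matrix_matrix_mult_def sum.distrib distrib_left distrib_right scaleR_sum_right)

lemma bounded_bilinear_matrix_vector_mult:
  "bounded_bilinear ((*v) :: complex^'n^'m \<Rightarrow> complex^'n \<Rightarrow> complex^'m)"
  by (simp flip: bilinear_conv_bounded_bilinear add: bilinear_def linear_iff vec_eq_iff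
      matrix_vector_mult_def sum.distrib distrib_left distrib_right scaleR_sum_right)

lemmas tendsto_matrix_mult = bounded_bilinear.tendsto[OF bounded_bilinear_matrix_mult]
lemmas tendsto_matrix_vector_mult = bounded_bilinear.tendsto[OF bounded_bilinear_matrix_vector_mult]

lemma tendsto_matrix_iff:
  fixes X :: "'a \<Rightarrow> 'b::real_normed_vector^'n^'m"
  shows "(X \<longlongrightarrow> L) F \<longleftrightarrow> (\<forall>i j. ((\<lambda>t. X t $ i $ j) \<longlongrightarrow> L $ i $ j) F)"
  by (auto intro: tendsto_vec_nth vec_tendstoI)

lemma tendsto_det:
  fixes X :: "'a \<Rightarrow> complex^'n^'n"
  assumes "(X \<longlongrightarrow> L) F"
  shows "((\<lambda>t. det (X t)) \<longlongrightarrow> det L) F"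
  unfolding det_def by (intro tendsto_intros assms)

lemma has_vector_derivative_vec:
  fixes Z :: "real \<Rightarrow> 'a::real_normed_vector^'n"
  assumes "\<And>i. ((\<lambda>y. Z y $ i) has_vector_derivative Z' $ i) (at y)"
  shows "(Z has_vector_derivative Z') (at y)"
proof -
  have "(Z has_derivative (\<lambda>x. x *\<^sub>R Z')) (at y)"
    unfolding has_derivative_within
  proof (intro conjI vec_tendstoI)
    show "bounded_linear (\<lambda>x. x *\<^sub>R Z')" by (rule bounded_linear_scaleR_left)
    fix i
    show "((\<lambda>x. ((1 / norm (x - y)) *\<^sub>R (Z x - (Z y + (x - y) *\<^sub>R Z'))) $ i) \<longlongrightarrow> 0 $ i) (at y)"
      using assms[of i] by (simp add: has_vector_derivative_def has_derivative_within)
  qed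
  then show ?thesis by (simp add: has_vector_derivative_def)
qed

lemma injective_matrix_left_inverse:
  fixes S :: "complex^'k^'n"
  assumes "inj ((*v) S)"
  obtains L where "L ** S = mat 1"
  using assms matrix_left_invertible_injective[of S] by (auto simp: inj_def inj_on_def)

text \<open>Coefficients are chosen column by column. Membership is asked of functions of
  \<open>t\<close>, so one coefficient vector serves all \<open>t\<close> and \<open>B\<close> is
  constant. For solution matrices this expresses one basis through another.\<close>

lemma matrix_factor:
  fixes X Y :: "'a \<Rightarrow> complex^'k^'n"
  assumes "\<And>c. (\<lambda>t. Y t *v c) \<in> range (\<lambda>c t. X t *v c)"
  obtains B where "\<And>t. Y t = X t ** B"
proof -
  have "\<exists>c. (\<lambda>t. Y t *v axis j 1) = (\<lambda>t. X t *v c)" for j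
    using assms[of "axis j 1"] by blast
  then obtain c where c: "(\<lambda>t. Y t *v axis j 1) = (\<lambda>t. X t *v c j)" for j by metis
  have "Y t = X t ** (\<chi> i j. c j $ i)" for t
  proof -
    have "Y t $ i $ j = (X t ** (\<chi> i j. c j $ i)) $ i $ j" for i j
      using fun_cong[OF c[of j], of t]
      by (simp add: vec_eq_iff matrix_matrix_mult_def matrix_vector_mult_def axis_def
          if_distrib cong: if_cong)
    then show ?thesis by (simp add: vec_eq_iff)
  qed
  with that show ?thesis by blast
qed

lemma matrix_basis_change:
  fixes X Y :: "complex^'k^'n"
  assumes X: "bij_betw ((*v) X) UNIV V" and Y: "bij_betw ((*v) Y) UNIV V"
  obtains B where "Y = X ** B" "det B \<noteq> 0"
proof -
  have factor: "\<exists>B. Y = X ** B"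
    if "range ((*v) Y) = range ((*v) X)" for X Y :: "complex^'k^'n"
  proof -
    \<comment> \<open>Over the one-point index type \<open>matrix_factor\<close> speaks about single
      matrices.\<close>
    have "(\<lambda>t::unit. Y *v c) \<in> range (\<lambda>c t. X *v c)" for c
      using that by (auto simp: image_iff fun_eq_iff set_eq_iff)
    from matrix_factor[of "\<lambda>t. Y" "\<lambda>t. X", OF this] show ?thesis by blast
  qed
  obtain B B' where B: "Y = X ** B" and B': "X = Y ** B'"
    using factor[of X Y] factor[of Y X] X Y unfolding bij_betw_def by blast
  obtain L where L: "L ** X = mat 1"
    using X injective_matrix_left_inverse unfolding bij_betw_def by blast
  \<comment> \<open>A left inverse of the injective \<open>X\<close> cancels it from
    \<open>X = X ** B ** B'\<close>, so \<open>B\<close> is invertible.\<close>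
  have "B ** B' = L ** X ** (B ** B')" by (simp add: L)
  also have "\<dots> = L ** (X ** B ** B')" by (simp only: matrix_mul_assoc)
  also have "\<dots> = mat 1" using B B' L by metis
  finally have "det B \<noteq> 0"
    by (metis det_I det_mul mult_zero_left zero_neq_one)
  with B that show ?thesis by blast
qed

text \<open>Conjugating the exponential series termwise needs its convergence.\<close>
lemma mat_exp_sums:
  fixes A :: "complex^'k^'k"
  shows "(\<lambda>n. (1 / fact n) *\<^sub>R (((**) A ^^ n) (mat 1))) sums mat_exp A"
proof -
  obtain K where K: "K \<ge> 0" "\<And>(A :: complex^'k^'k) (B :: complex^'k^'k). norm (A ** B) \<le> norm A * norm B * K"
    using bounded_bilinear.nonneg_bounded[OF bounded_bilinear_matrix_mult] by blast
  \<comment> \<open>The norm is submultiplicative up to the factor \<open>K\<close>, so the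
    comparison series is the exponential series of \<open>norm A * K\<close>.\<close>
  define r where "r = norm A * K"
  have bound: "norm (((**) A ^^ n) (mat 1)) \<le> r ^ n * norm (mat 1 :: complex^'k^'k)" for n
  proof (induction n)
    case (Suc n)
    have "norm (((**) A ^^ Suc n) (mat 1)) \<le> r * norm (((**) A ^^ n) (mat 1))"
      using K(2)[of A "((**) A ^^ n) (mat 1)"] by (simp add: r_def mult_ac)
    also have "\<dots> \<le> r * (r ^ n * norm (mat 1 :: complex^'k^'k))"
      using Suc K(1) by (intro mult_left_mono) (auto simp: r_def)
    finally show ?case by (simp add: mult_ac)
  qed simp
  have "summable (\<lambda>n. (1 / fact n) *\<^sub>R (((**) A ^^ n) (mat 1)))"
  proof (rule summable_comparison_test'[where N = 0])
    show "summable (\<lambda>n. (inverse (fact n) * r ^ n) * norm (mat 1 :: complex^'k^'k))"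
      by (intro summable_mult2 summable_exp)
    show "norm ((1 / fact n) *\<^sub>R (((**) A ^^ n) (mat 1)))
        \<le> (inverse (fact n) * r ^ n) * norm (mat 1 :: complex^'k^'k)" for n
      using bound[of n] by (simp add: divide_simps)
  qed
  then show ?thesis unfolding mat_exp_def by (rule summable_sums)
qed

text \<open>The powers intertwine by induction, and multiplication by \<open>C\<close> passes
  through the series by continuity.\<close>

lemma mat_exp_intertwine:
  fixes A B C :: "complex^'k^'k"
  assumes "A ** C = C ** B"
  shows "mat_exp A ** C = C ** mat_exp B"
proof -
  have "((**) A ^^ n) (mat 1) ** C = C ** ((**) B ^^ n) (mat 1)" for n
    by (induction n) (simp_all add: assms flip: matrix_mul_assoc, simp add: assms matrix_mul_assoc)
  then have *: "((1 / fact n) *\<^sub>R (((**) A ^^ n) (mat 1))) ** C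
      = C ** ((1 / fact n) *\<^sub>R (((**) B ^^ n) (mat 1)))" for n
    by (simp add: bounded_bilinear.scaleR_left[OF bounded_bilinear_matrix_mult]
        bounded_bilinear.scaleR_right[OF bounded_bilinear_matrix_mult])
  show ?thesis
    using bounded_linear.sums[OF bounded_bilinear.bounded_linear_left[OF bounded_bilinear_matrix_mult]
        mat_exp_sums[of A], of C]
      bounded_linear.sums[OF bounded_bilinear.bounded_linear_right[OF bounded_bilinear_matrix_mult]
        mat_exp_sums[of B], of C]
    unfolding * by (rule sums_unique2)
qed

section \<open>Limits of derivatives and cancellation of matrix factors\<close>

lemma tendsto_derivative_zero_real:
  fixes f f' :: "real \<Rightarrow> real"
  assumes "(f \<longlongrightarrow> l) at_top" "\<And>y. (f has_real_derivative f' y) (at y)" "(f' \<longlongrightarrow> l') at_top"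
  shows "l' = 0"
proof (rule tendsto_unique[OF trivial_limit_at_top_linorder])
  \<comment> \<open>L'Hospital's rule gives this quotient the limit \<open>l'\<close>, while
    convergence of \<open>f\<close> gives it the limit 0.\<close>
  show "((\<lambda>y. f y / y) \<longlongrightarrow> l') at_top"
    by (rule lhospital_at_top_at_top[where f' = f' and g' = "\<lambda>_. 1"])
      (use assms in \<open>auto intro: filterlim_ident\<close>)
  show "((\<lambda>y. f y / y) \<longlongrightarrow> 0) at_top"
    using assms(1) by (intro tendsto_divide_0 filterlim_at_top_imp_at_infinity filterlim_ident)
qed

text \<open>Pairing with basis vectors reduces this to real functions, and the reflection of the
  line reduces \<open>at_bot\<close> to \<open>at_top\<close>.\<close>

lemma tendsto_derivative_zero:
  fixes f f' :: "real \<Rightarrow> 'a::euclidean_space"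
  assumes F: "F = at_top \<or> F = at_bot" and f: "(f \<longlongrightarrow> l) F"
    and f': "\<And>y. (f has_vector_derivative f' y) (at y)" "(f' \<longlongrightarrow> l') F"
  shows "l' = 0"
proof (rule euclidean_eqI)
  fix b :: 'a
  have d: "((\<lambda>y. f y \<bullet> b) has_real_derivative f' y \<bullet> b) (at y)" for y
    using bounded_linear.has_vector_derivative[OF bounded_linear_inner_left f'(1)]
    by (simp add: has_real_derivative_iff_has_vector_derivative)
  have l: "((\<lambda>y. f y \<bullet> b) \<longlongrightarrow> l \<bullet> b) F" "((\<lambda>y. f' y \<bullet> b) \<longlongrightarrow> l' \<bullet> b) F"
    by (intro tendsto_intros f f')+
  show "l' \<bullet> b = 0 \<bullet> b"
    using F
  proof
    assume "F = at_top"
    with l d show ?thesis using tendsto_derivative_zero_real[OF _ d] by simp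
  next
    assume [simp]: "F = at_bot"
    have d': "((\<lambda>y. f (- y) \<bullet> b) has_real_derivative - (f' (- y) \<bullet> b)) (at y)" for y
      using d[of "- y"] by (simp add: DERIV_mirror)
    moreover have "((\<lambda>y. f (- y) \<bullet> b) \<longlongrightarrow> l \<bullet> b) at_top"
      "((\<lambda>y. - (f' (- y) \<bullet> b)) \<longlongrightarrow> - (l' \<bullet> b)) at_top"
      using l by (auto simp: filterlim_at_bot_mirror intro!: tendsto_minus)
    ultimately have "- (l' \<bullet> b) = 0" using tendsto_derivative_zero_real[OF _ d'] by blast
    then show ?thesis by simp
  qed
qed

text \<open>Once \<open>G t\<close> is close to the identity, \<open>(G t - mat 1) ** X t\<close>
  accounts for at most half of \<open>X t\<close>, so the norm of \<open>X t\<close> is at most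
  twice that of \<open>G t ** X t\<close>. The radius \<open>1 / (2 * K)\<close> absorbs the bound
  \<open>K\<close> of the product.\<close>

lemma tendsto_matrix_cancel:
  fixes X :: "'a \<Rightarrow> complex^'k^'n"
  assumes G: "(G \<longlongrightarrow> mat 1) F" and GX: "((\<lambda>t. G t ** X t) \<longlongrightarrow> 0) F"
  shows "(X \<longlongrightarrow> 0) F"
proof (rule tendsto_0_le[OF GX])
  obtain K where K: "K > 0"
      "\<And>(A :: complex^'n^'n) (B :: complex^'k^'n). norm (A ** B) \<le> norm A * norm B * K"
    using bounded_bilinear.pos_bounded[OF bounded_bilinear_matrix_mult] by blast
  have "\<forall>\<^sub>F t in F. dist (G t) (mat 1) < 1 / (2 * K)"
    using K(1) by (intro tendstoD[OF G]) simp
  then show "\<forall>\<^sub>F t in F. norm (X t) \<le> norm (G t ** X t) * 2"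
  proof eventually_elim
    case (elim t)
    have "norm (X t) = norm (G t ** X t - (G t - mat 1) ** X t)"
      by (simp add: bounded_bilinear.diff_left[OF bounded_bilinear_matrix_mult])
    also have "\<dots> \<le> norm (G t ** X t) + norm (G t - mat 1) * norm (X t) * K"
      using norm_triangle_ineq4 K(2) order_trans add_left_mono by meson
    also have "norm (G t - mat 1) * norm (X t) * K \<le> 1 / (2 * K) * norm (X t) * K"
      using elim K(1) by (intro mult_right_mono) (auto simp: dist_norm)
    finally show ?case using K(1) by simp
  qed
qed

subsection \<open>Conjugation of Kato bases and Evans functions\<close>

text \<open>Scalar matrices commute with \<open>T\<close>, so \<open>T\<close> intertwines the
  shifted matrices and hence all their powers.\<close>

lemma gen_eigenspace_intertwine:
  fixes T N\<^sub>1 N\<^sub>2 :: "complex^'n^'n"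
  assumes "N\<^sub>2 ** T = T ** N\<^sub>1" "v \<in> gen_eigenspace N\<^sub>1 \<nu>"
  shows "T *v v \<in> gen_eigenspace N\<^sub>2 \<nu>"
proof -
  have step: "(N\<^sub>2 - mat \<nu>) *v (T *v x) = T *v ((N\<^sub>1 - mat \<nu>) *v x)" for x
  proof -
    have "mat \<nu> *v y = \<nu> *s y" for y :: "complex^'n"
      by (simp add: vec_eq_iff matrix_vector_mult_def mat_def if_distrib if_distribR cong: if_cong)
    moreover have "N\<^sub>2 *v (T *v x) = T *v (N\<^sub>1 *v x)"
      by (simp add: matrix_vector_mul_assoc assms(1))
    ultimately show ?thesis
      by (simp add: matrix_vector_mult_diff_rdistrib matrix_vector_mult_diff_distrib
          vector_scalar_commute)
  qed
  have "(((*v) (N\<^sub>2 - mat \<nu>)) ^^ k) (T *v v) = T *v (((*v) (N\<^sub>1 - mat \<nu>)) ^^ k) v" for k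
    by (induction k) (simp_all add: step)
  moreover obtain k where "(((*v) (N\<^sub>1 - mat \<nu>)) ^^ k) v = 0"
    using assms(2) unfolding gen_eigenspace_def by blast
  ultimately have "(((*v) (N\<^sub>2 - mat \<nu>)) ^^ k) (T *v v) = 0" by simp
  then show ?thesis unfolding gen_eigenspace_def by blast
qed

lemma spectral_subspace_intertwine:
  fixes T N\<^sub>1 N\<^sub>2 :: "complex^'n^'n"
  assumes "N\<^sub>2 ** T = T ** N\<^sub>1"
  shows "(*v) T ` spectral_subspace N\<^sub>1 R \<subseteq> spectral_subspace N\<^sub>2 R"
proof -
  have "(*v) T ` vec.span X = vec.span ((*v) T ` X)" for X
    by (simp add: vec.linear_span_image)
  then show ?thesis
    unfolding spectral_subspace_def
    using gen_eigenspace_intertwine[OF assms] by (auto intro!: vec.span_mono subsetD[OF vec.span_mono])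
qed

text \<open>The inverse of \<open>T\<close> intertwines in the opposite direction and supplies the
  reverse inclusion.\<close>

lemma spectral_subspace_conjugate:
  fixes T N\<^sub>1 N\<^sub>2 :: "complex^'n^'n"
  assumes NT: "N\<^sub>2 ** T = T ** N\<^sub>1" and T: "det T \<noteq> 0"
  shows "bij_betw ((*v) T) (spectral_subspace N\<^sub>1 R) (spectral_subspace N\<^sub>2 R)"
proof -
  obtain T' where T': "T ** T' = mat 1" "T' ** T = mat 1"
    using T invertible_det_nz[of T] unfolding invertible_def by blast
  have "N\<^sub>1 ** T' = T' ** N\<^sub>2"
    by (metis NT T' matrix_mul_assoc matrix_mul_lid matrix_mul_rid)
  then have "(*v) T' ` spectral_subspace N\<^sub>2 R \<subseteq> spectral_subspace N\<^sub>1 R"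
    by (rule spectral_subspace_intertwine)
  with spectral_subspace_intertwine[OF NT, of R] show ?thesis
    by (intro bij_betw_byWitness[where f' = "(*v) T'"])
      (auto simp: matrix_vector_mul_assoc T')
qed

text \<open>Split \<open>v\<close> into \<open>Q\<^sub>1 *v v\<close> and the remainder. Ranges and
  kernels of the projections are spectral subspaces, which \<open>T\<close> respects, so
  \<open>Q\<^sub>2\<close> fixes the image of the first part and kills that of the second.\<close>

lemma spectral_projection_intertwine:
  fixes T N\<^sub>1 N\<^sub>2 :: "complex^'n^'n"
  assumes NT: "N\<^sub>2 ** T = T ** N\<^sub>1"
    and "spectral_projection N\<^sub>1 R Q\<^sub>1" "spectral_projection N\<^sub>2 R Q\<^sub>2"
  shows "Q\<^sub>2 ** T = T ** Q\<^sub>1"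
proof -
  have "Q\<^sub>2 *v (T *v v) = T *v (Q\<^sub>1 *v v)" for v
  proof -
    have Q1: "Q\<^sub>1 *v (Q\<^sub>1 *v x) = Q\<^sub>1 *v x" and Q2: "Q\<^sub>2 *v (Q\<^sub>2 *v y) = Q\<^sub>2 *v y" for x y
      using assms(2,3) by (simp_all add: spectral_projection_def matrix_vector_mul_assoc)
    have "Q\<^sub>1 *v v \<in> spectral_subspace N\<^sub>1 R"
      using assms(2) by (auto simp: spectral_projection_def)
    then have "T *v (Q\<^sub>1 *v v) \<in> range ((*v) Q\<^sub>2)"
      using spectral_subspace_intertwine[OF NT, of R] assms(3) by (auto simp: spectral_projection_def)
    then have 1: "Q\<^sub>2 *v (T *v (Q\<^sub>1 *v v)) = T *v (Q\<^sub>1 *v v)"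
      using Q2 by auto
    have "v - Q\<^sub>1 *v v \<in> spectral_subspace N\<^sub>1 (\<lambda>\<nu>. \<not> R \<nu>)"
      using assms(2) Q1 by (auto simp: spectral_projection_def matrix_vector_mult_diff_distrib)
    then have "T *v (v - Q\<^sub>1 *v v) \<in> {v. Q\<^sub>2 *v v = 0}"
      using spectral_subspace_intertwine[OF NT, of "\<lambda>\<nu>. \<not> R \<nu>"] assms(3)
      by (auto simp: spectral_projection_def)
    with 1 show ?thesis by (simp add: matrix_vector_mult_diff_distrib)
  qed
  then show ?thesis by (simp add: matrix_eq matrix_vector_mul_assoc)
qed

section \<open>Kato's equation on the punctured half-plane\<close>

lemma at_within_evans_region_nontrivial:
  assumes "\<mu> \<in> evans_region"
  shows "at \<mu> within evans_region \<noteq> bot"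
  unfolding trivial_limit_within islimpt_approachable not_not
proof (intro allI impI)
  fix e :: real assume "e > 0"
  \<comment> \<open>A shift to the right stays in the region, also from the imaginary axis.\<close>
  then show "\<exists>x\<in>evans_region. x \<noteq> \<mu> \<and> dist x \<mu> < e"
    using assms by (intro bexI[of _ "\<mu> + of_real (e / 2)"])
      (auto simp: evans_region_def dist_norm complex_eq_iff)
qed

lemma evans_region_zero_derivative_constant:
  assumes f: "\<And>\<mu>. \<mu> \<in> evans_region \<Longrightarrow> (f has_field_derivative 0) (at \<mu> within evans_region)"
    and \<mu>: "\<mu> \<in> evans_region"
  shows "f \<mu> = f 1"
proof -
  text \<open>The punctured half-plane is the union of two convex sectors meeting at 1.\<close>
  define H where "H s = {\<mu>. Re \<mu> \<ge> 0} \<inter> {\<mu>. Re \<mu> + s * Im \<mu> > 0}" for s :: real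
  have "convex {\<mu>. Re \<mu> + s * Im \<mu> > 0}" for s
    using convex_halfspace_gt[of 0 "Complex 1 s"] by (simp add: inner_complex_def)
  then have conv: "convex (H s)" for s
    unfolding H_def by (intro convex_Int convex_halfspace_Re_ge)
  have sub: "H s \<subseteq> evans_region" for s
    by (auto simp: H_def evans_region_def)
  have "f z = f 1" if "z \<in> H s" for z s
  proof -
    have "\<forall>x\<in>H s. (f has_field_derivative 0) (at x within H s)"
      using f sub DERIV_subset by blast
    then obtain c where "\<forall>x\<in>H s. f x = c"
      using has_field_derivative_zero_constant[OF conv] by metis
    moreover have "1 \<in> H s" by (simp add: H_def)
    ultimately show ?thesis using that by auto
  qed
  \<comment> \<open>Each sector contains one half of the punctured imaginary axis.\<close>
  moreover have "\<mu> \<in> H 1 \<or> \<mu> \<in> H (-1)"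
    using \<mu> by (auto simp: H_def evans_region_def complex_eq_iff)
  ultimately show ?thesis by blast
qed

text \<open>Differentiating \<open>S\<^sub>2 = S\<^sub>1 ** C\<close> would show that the derivative
  of \<open>C\<close> vanishes, but \<open>C\<close> is obtained pointwise and its differentiability
  is not known beforehand. Difference quotients give existence and vanishing of the derivative at
  once.\<close>

lemma kato_solutions_constant_change:
  fixes S\<^sub>1 S\<^sub>2 :: "complex \<Rightarrow> complex^'k^'n" and Q' :: "complex \<Rightarrow> complex^'n^'n"
  assumes S1: "\<And>\<mu> i j. \<mu> \<in> evans_region \<Longrightarrow>
      ((\<lambda>l. S\<^sub>1 l $ i $ j) has_field_derivative (Q' \<mu> ** S\<^sub>1 \<mu>) $ i $ j) (at \<mu> within evans_region)"
    and S2: "\<And>\<mu> i j. \<mu> \<in> evans_region \<Longrightarrow>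
      ((\<lambda>l. S\<^sub>2 l $ i $ j) has_field_derivative (Q' \<mu> ** S\<^sub>2 \<mu>) $ i $ j) (at \<mu> within evans_region)"
    and bij: "\<And>\<mu>. \<mu> \<in> evans_region \<Longrightarrow> bij_betw ((*v) (S\<^sub>1 \<mu>)) UNIV (V \<mu>)"
      "\<And>\<mu>. \<mu> \<in> evans_region \<Longrightarrow> bij_betw ((*v) (S\<^sub>2 \<mu>)) UNIV (V \<mu>)"
  obtains C where "det C \<noteq> 0" "\<And>\<mu>. \<mu> \<in> evans_region \<Longrightarrow> S\<^sub>2 \<mu> = S\<^sub>1 \<mu> ** C"
proof -
  have "\<exists>C. S\<^sub>2 \<mu> = S\<^sub>1 \<mu> ** C \<and> det C \<noteq> 0" if "\<mu> \<in> evans_region" for \<mu>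
    using matrix_basis_change[OF bij[OF that]] by metis
  then obtain C where C: "\<mu> \<in> evans_region \<Longrightarrow> S\<^sub>2 \<mu> = S\<^sub>1 \<mu> ** C \<mu>"
      "\<mu> \<in> evans_region \<Longrightarrow> det (C \<mu>) \<noteq> 0" for \<mu>
    by metis
  have C': "((\<lambda>\<mu>. C \<mu> $ i $ j) has_field_derivative 0) (at \<nu> within evans_region)"
    if \<nu>: "\<nu> \<in> evans_region" for \<nu> i j
  proof -
    let ?F = "at \<nu> within evans_region"
    obtain L where L: "L ** S\<^sub>1 \<nu> = mat 1"
      using bij(1)[OF \<nu>] injective_matrix_left_inverse unfolding bij_betw_def by blast
    \<comment> \<open>\<open>X\<close> is the difference quotient of \<open>C\<close> at \<nu>, and
      \<open>Y\<close> that of \<open>S\<^sub>2 - S\<^sub>1 ** C \<nu>\<close>. The latter function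
      solves Kato's equation and vanishes at \<nu>, so \<open>Y\<close> tends to 0; moreover
      \<open>S\<^sub>1 \<mu> ** X \<mu> = Y \<mu>\<close>.\<close>
    define X where "X \<mu> = (\<chi> i j. (C \<mu> $ i $ j - C \<nu> $ i $ j) / (\<mu> - \<nu>))" for \<mu>
    define Y where "Y \<mu> = (\<chi> i j. ((S\<^sub>2 \<mu> - S\<^sub>1 \<mu> ** C \<nu>) $ i $ j) / (\<mu> - \<nu>))" for \<mu>
    have "(Y \<longlongrightarrow> 0) ?F"
      unfolding tendsto_matrix_iff
    proof (intro allI)
      fix i j
      have "((\<lambda>\<mu>. (S\<^sub>2 \<mu> - S\<^sub>1 \<mu> ** C \<nu>) $ i $ j) has_field_derivative
          (Q' \<nu> ** S\<^sub>2 \<nu>) $ i $ j - ((Q' \<nu> ** S\<^sub>1 \<nu>) ** C \<nu>) $ i $ j) ?F"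
        unfolding vector_minus_component matrix_matrix_mult_def[of _ "C \<nu>"] vec_lambda_beta
        by (intro DERIV_diff S2[OF \<nu>] DERIV_sum DERIV_cmult_right S1[OF \<nu>])
      then have "((\<lambda>\<mu>. (S\<^sub>2 \<mu> - S\<^sub>1 \<mu> ** C \<nu>) $ i $ j) has_field_derivative 0) ?F"
        by (simp add: C(1)[OF \<nu>] matrix_mul_assoc)
      then show "((\<lambda>\<mu>. Y \<mu> $ i $ j) \<longlongrightarrow> 0 $ i $ j) ?F"
        unfolding has_field_derivative_iff by (simp add: Y_def C(1)[OF \<nu>])
    qed
    then have LY: "((\<lambda>\<mu>. L ** Y \<mu>) \<longlongrightarrow> L ** 0) ?F"
      by (intro tendsto_matrix_mult tendsto_const)
    \<comment> \<open>Continuity of \<open>S\<^sub>1\<close> brings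
      \<open>L ** S\<^sub>1 \<mu>\<close> near the identity, which allows it to be
      cancelled.\<close>
    have "(S\<^sub>1 \<longlongrightarrow> S\<^sub>1 \<nu>) ?F"
      using DERIV_continuous[OF S1[OF \<nu>]] unfolding tendsto_matrix_iff continuous_within by blast
    then have G: "((\<lambda>\<mu>. L ** S\<^sub>1 \<mu>) \<longlongrightarrow> mat 1) ?F"
      unfolding L[symmetric] by (intro tendsto_matrix_mult tendsto_const)
    have "L ** S\<^sub>1 \<mu> ** X \<mu> = L ** Y \<mu>" if \<mu>: "\<mu> \<in> evans_region" for \<mu>
    proof -
      have "S\<^sub>1 \<mu> ** X \<mu> = Y \<mu>"
        by (simp add: vec_eq_iff X_def Y_def C(1)[OF \<mu>] matrix_matrix_mult_def
            right_diff_distrib sum_subtractf flip: sum_divide_distrib)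
      then show ?thesis by (simp only: matrix_mul_assoc[symmetric])
    qed
    then have "\<forall>\<^sub>F \<mu> in ?F. L ** S\<^sub>1 \<mu> ** X \<mu> = L ** Y \<mu>"
      by (auto simp: eventually_at_filter)
    then have "((\<lambda>\<mu>. L ** S\<^sub>1 \<mu> ** X \<mu>) \<longlongrightarrow> 0) ?F"
      using LY by (simp add: tendsto_cong bounded_bilinear.zero_right[OF bounded_bilinear_matrix_mult])
    from tendsto_matrix_cancel[OF G this] show ?thesis
      by (simp add: has_field_derivative_iff tendsto_matrix_iff X_def)
  qed
  have const: "C \<mu> = C 1" if "\<mu> \<in> evans_region" for \<mu>
    using evans_region_zero_derivative_constant[OF C' that] by (simp add: vec_eq_iff)
  show ?thesis
  proof (rule that)
    show "det (C 1) \<noteq> 0" by (rule C(2)) (simp add: evans_region_def)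
    show "S\<^sub>2 \<mu> = S\<^sub>1 \<mu> ** C 1" if "\<mu> \<in> evans_region" for \<mu>
      using C(1)[OF that] unfolding const[OF that] .
  qed
qed

text \<open>A similarity that does not depend on the spectral parameter commutes with Kato's equation.\<close>
lemma kato_basis_conjugate:
  fixes S\<^sub>1 S\<^sub>2 :: "complex \<Rightarrow> complex^'k^3"
  assumes K: "kato_basis N\<^sub>1 R S\<^sub>1" "kato_basis N\<^sub>2 R S\<^sub>2"
    and NT: "\<And>\<mu>. \<mu> \<in> evans_region \<Longrightarrow> N\<^sub>2 \<mu> ** T = T ** N\<^sub>1 \<mu>" and T: "det T \<noteq> 0"
  obtains C where "det C \<noteq> 0" "\<And>\<mu>. \<mu> \<in> evans_region \<Longrightarrow> S\<^sub>2 \<mu> = T ** S\<^sub>1 \<mu> ** C"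
proof -
  obtain Q\<^sub>1 Q\<^sub>1' where Q1: "\<And>\<mu>. \<mu> \<in> evans_region \<Longrightarrow> spectral_projection (N\<^sub>1 \<mu>) R (Q\<^sub>1 \<mu>)"
      "\<And>\<mu> i j. \<mu> \<in> evans_region \<Longrightarrow>
        ((\<lambda>l. Q\<^sub>1 l $ i $ j) has_field_derivative Q\<^sub>1' \<mu> $ i $ j) (at \<mu> within evans_region)"
      "\<And>\<mu> i j. \<mu> \<in> evans_region \<Longrightarrow>
        ((\<lambda>l. S\<^sub>1 l $ i $ j) has_field_derivative (Q\<^sub>1' \<mu> ** S\<^sub>1 \<mu>) $ i $ j) (at \<mu> within evans_region)"
      "\<And>\<mu>. \<mu> \<in> evans_region \<Longrightarrow> bij_betw ((*v) (S\<^sub>1 \<mu>)) UNIV (spectral_subspace (N\<^sub>1 \<mu>) R)"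
    using K(1) unfolding kato_basis_def by metis
  obtain Q\<^sub>2 Q\<^sub>2' where Q2: "\<And>\<mu>. \<mu> \<in> evans_region \<Longrightarrow> spectral_projection (N\<^sub>2 \<mu>) R (Q\<^sub>2 \<mu>)"
      "\<And>\<mu> i j. \<mu> \<in> evans_region \<Longrightarrow>
        ((\<lambda>l. Q\<^sub>2 l $ i $ j) has_field_derivative Q\<^sub>2' \<mu> $ i $ j) (at \<mu> within evans_region)"
      "\<And>\<mu> i j. \<mu> \<in> evans_region \<Longrightarrow>
        ((\<lambda>l. S\<^sub>2 l $ i $ j) has_field_derivative (Q\<^sub>2' \<mu> ** S\<^sub>2 \<mu>) $ i $ j) (at \<mu> within evans_region)"
      "\<And>\<mu>. \<mu> \<in> evans_region \<Longrightarrow> bij_betw ((*v) (S\<^sub>2 \<mu>)) UNIV (spectral_subspace (N\<^sub>2 \<mu>) R)"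
    using K(2) unfolding kato_basis_def by metis
  have QT: "Q\<^sub>2 \<mu> ** T = T ** Q\<^sub>1 \<mu>" if "\<mu> \<in> evans_region" for \<mu>
    using spectral_projection_intertwine NT Q1(1) Q2(1) that by blast
  \<comment> \<open>By \<open>QT\<close> both sides are derivatives of the same function, and
    derivatives within the region are unique.\<close>
  have Q'T: "Q\<^sub>2' \<mu> ** T = T ** Q\<^sub>1' \<mu>" if \<mu>: "\<mu> \<in> evans_region" for \<mu>
  proof -
    have "(Q\<^sub>2' \<mu> ** T) $ i $ j = (T ** Q\<^sub>1' \<mu>) $ i $ j" for i j
    proof -
      have 1: "((\<lambda>l. (Q\<^sub>2 l ** T) $ i $ j) has_field_derivative (Q\<^sub>2' \<mu> ** T) $ i $ j)
          (at \<mu> within evans_region)"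
        unfolding matrix_matrix_mult_def vec_lambda_beta
        by (intro DERIV_sum DERIV_cmult_right Q2(2)[OF \<mu>])
      have "((\<lambda>l. (T ** Q\<^sub>1 l) $ i $ j) has_field_derivative (T ** Q\<^sub>1' \<mu>) $ i $ j)
          (at \<mu> within evans_region)"
        unfolding matrix_matrix_mult_def vec_lambda_beta
        by (intro DERIV_sum DERIV_cmult Q1(2)[OF \<mu>])
      then have 2: "((\<lambda>l. (Q\<^sub>2 l ** T) $ i $ j) has_field_derivative (T ** Q\<^sub>1' \<mu>) $ i $ j)
          (at \<mu> within evans_region)"
        by (rule has_field_derivative_transform_within[where d = 1]) (use \<mu> QT in auto)
      show ?thesis
        using tendsto_unique[OF at_within_evans_region_nontrivial[OF \<mu>]] 1 2
        unfolding has_field_derivative_iff by blast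
    qed
    then show ?thesis by (simp add: vec_eq_iff)
  qed
  \<comment> \<open>As \<open>T\<close> is constant, \<open>T ** S\<^sub>1\<close> solves the same
    Kato equation as \<open>S\<^sub>2\<close>.\<close>
  have TS: "((\<lambda>l. (T ** S\<^sub>1 l) $ i $ j) has_field_derivative (Q\<^sub>2' \<mu> ** (T ** S\<^sub>1 \<mu>)) $ i $ j)
      (at \<mu> within evans_region)" if \<mu>: "\<mu> \<in> evans_region" for \<mu> i j
  proof -
    have "((\<lambda>l. (T ** S\<^sub>1 l) $ i $ j) has_field_derivative (T ** (Q\<^sub>1' \<mu> ** S\<^sub>1 \<mu>)) $ i $ j)
        (at \<mu> within evans_region)"
      unfolding matrix_matrix_mult_def[of T] vec_lambda_beta
      by (intro DERIV_sum DERIV_cmult Q1(3)[OF \<mu>])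
    then show ?thesis by (simp add: matrix_mul_assoc Q'T[OF \<mu>])
  qed
  have bij: "bij_betw ((*v) (T ** S\<^sub>1 \<mu>)) UNIV (spectral_subspace (N\<^sub>2 \<mu>) R)"
    if \<mu>: "\<mu> \<in> evans_region" for \<mu>
    using bij_betw_trans[OF Q1(4)[OF \<mu>] spectral_subspace_conjugate[OF NT[OF \<mu>] T]]
    by (simp add: o_def matrix_vector_mul_assoc)
  show ?thesis
    by (rule kato_solutions_constant_change[OF TS Q2(3) bij Q2(4)]) (use that in auto)
qed

text \<open>The columns of \<open>T ** Z\<^sub>1\<close> solve the second system and decay, so they
  equal \<open>Z\<^sub>2 ** B\<close> with constant \<open>B\<close>. The normalization makes
  \<open>B ** C\<close>, conjugated by the exponentials, tend to the identity. This need not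
  determine \<open>B ** C\<close>, but it does determine its determinant, which conjugation
  preserves.\<close>

lemma decaying_basis_conjugate:
  fixes Z\<^sub>1 Z\<^sub>2 :: "real \<Rightarrow> complex^'k^3"
  assumes F: "F \<noteq> bot"
    and T': "\<And>y. (T has_vector_derivative M\<^sub>2 y ** T y - T y ** M\<^sub>1 y) (at y)"
    and T: "(T \<longlongrightarrow> T\<^sub>0) F" and NT: "N\<^sub>2 ** T\<^sub>0 = T\<^sub>0 ** N\<^sub>1"
    and Z1: "decaying_basis M\<^sub>1 N\<^sub>1 F S\<^sub>1 Z\<^sub>1" and Z2: "decaying_basis M\<^sub>2 N\<^sub>2 F S\<^sub>2 Z\<^sub>2"
    and S2: "S\<^sub>2 = T\<^sub>0 ** S\<^sub>1 ** C" "inj ((*v) S\<^sub>2)"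
  obtains B where "\<And>y. T y ** Z\<^sub>1 y = Z\<^sub>2 y ** B" "det B * det C = 1"
proof -
  obtain \<Lambda>\<^sub>1 where L1: "N\<^sub>1 ** S\<^sub>1 = S\<^sub>1 ** \<Lambda>\<^sub>1"
      "((\<lambda>y. Z\<^sub>1 y ** mat_exp (- y *\<^sub>R \<Lambda>\<^sub>1)) \<longlongrightarrow> S\<^sub>1) F"
    using Z1 unfolding decaying_basis_def by blast
  obtain \<Lambda>\<^sub>2 where L2: "N\<^sub>2 ** S\<^sub>2 = S\<^sub>2 ** \<Lambda>\<^sub>2"
      "((\<lambda>y. Z\<^sub>2 y ** mat_exp (- y *\<^sub>R \<Lambda>\<^sub>2)) \<longlongrightarrow> S\<^sub>2) F"
    using Z2 unfolding decaying_basis_def by blast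
  obtain L where L: "L ** S\<^sub>2 = mat 1"
    using S2(2) injective_matrix_left_inverse by blast
  have "(\<lambda>y. (T y ** Z\<^sub>1 y) *v c) \<in> range (\<lambda>c y. Z\<^sub>2 y *v c)" for c
  proof -
    have Z: "((\<lambda>y. Z\<^sub>1 y *v c) has_vector_derivative M\<^sub>1 y *v (Z\<^sub>1 y *v c)) (at y)"
        "((\<lambda>y. Z\<^sub>1 y *v c) \<longlongrightarrow> 0) F" for y
      using Z1 unfolding decaying_basis_def bij_betw_def decaying_solutions_def by blast+
    have "((\<lambda>y. T y *v (Z\<^sub>1 y *v c)) has_vector_derivative M\<^sub>2 y *v (T y *v (Z\<^sub>1 y *v c))) (at y)" for y
      using bounded_bilinear.has_vector_derivative[OF bounded_bilinear_matrix_vector_mult T' Z(1)]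
      by (simp add: matrix_vector_mul_assoc matrix_mul_assoc matrix_vector_mult_diff_rdistrib
          bounded_bilinear.diff_left[OF bounded_bilinear_matrix_mult])
    moreover have "((\<lambda>y. T y *v (Z\<^sub>1 y *v c)) \<longlongrightarrow> 0) F"
      using tendsto_matrix_vector_mult[OF T Z(2)] by simp
    ultimately have "(\<lambda>y. (T y ** Z\<^sub>1 y) *v c) \<in> decaying_solutions M\<^sub>2 F"
      unfolding decaying_solutions_def by (simp add: matrix_vector_mul_assoc)
    then show ?thesis using Z2 unfolding decaying_basis_def bij_betw_def by blast
  qed
  from matrix_factor[of "\<lambda>y. T y ** Z\<^sub>1 y" Z\<^sub>2, OF this]
  obtain B where B: "\<And>y. T y ** Z\<^sub>1 y = Z\<^sub>2 y ** B" by metis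
  \<comment> \<open>\<open>\<Lambda>\<^sub>1\<close> and \<open>\<Lambda>\<^sub>2\<close> represent
    the same map in the bases \<open>T\<^sub>0 ** S\<^sub>1\<close> and \<open>S\<^sub>2\<close>,
    which are related by \<open>C\<close>.\<close>
  have "T\<^sub>0 ** S\<^sub>1 ** (C ** \<Lambda>\<^sub>2) = S\<^sub>2 ** \<Lambda>\<^sub>2" by (simp only: S2(1) matrix_mul_assoc)
  also have "\<dots> = N\<^sub>2 ** S\<^sub>2" by (rule L2(1)[symmetric])
  also have "\<dots> = N\<^sub>2 ** T\<^sub>0 ** S\<^sub>1 ** C" by (simp only: S2(1) matrix_mul_assoc)
  also have "\<dots> = T\<^sub>0 ** (N\<^sub>1 ** S\<^sub>1) ** C" by (simp only: NT matrix_mul_assoc)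
  also have "\<dots> = T\<^sub>0 ** S\<^sub>1 ** (\<Lambda>\<^sub>1 ** C)" by (simp only: L1(1) matrix_mul_assoc)
  finally have "T\<^sub>0 ** S\<^sub>1 ** (C ** \<Lambda>\<^sub>2) = T\<^sub>0 ** S\<^sub>1 ** (\<Lambda>\<^sub>1 ** C)" .
  note S\<Lambda> = this
  \<comment> \<open>The left inverse \<open>L ** (T\<^sub>0 ** S\<^sub>1)\<close> of the square
    matrix \<open>C\<close> is also a right inverse.\<close>
  have CLTS: "C ** L ** (T\<^sub>0 ** S\<^sub>1) = mat 1"
  proof -
    have "L ** (T\<^sub>0 ** S\<^sub>1) ** C = mat 1" using L by (simp only: S2(1) matrix_mul_assoc)
    then have "C ** (L ** (T\<^sub>0 ** S\<^sub>1)) = mat 1" by (simp only: matrix_left_right_inverse)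
    then show ?thesis by (simp only: matrix_mul_assoc)
  qed
  have C\<Lambda>: "C ** \<Lambda>\<^sub>2 = \<Lambda>\<^sub>1 ** C"
  proof -
    have "C ** \<Lambda>\<^sub>2 = C ** L ** (T\<^sub>0 ** S\<^sub>1) ** (C ** \<Lambda>\<^sub>2)"
      by (simp only: CLTS matrix_mul_lid)
    also have "\<dots> = C ** L ** (T\<^sub>0 ** S\<^sub>1 ** (\<Lambda>\<^sub>1 ** C))"
      by (simp only: S\<Lambda> matrix_mul_assoc[symmetric, of "C ** L" "T\<^sub>0 ** S\<^sub>1"])
    also have "\<dots> = C ** L ** (T\<^sub>0 ** S\<^sub>1) ** (\<Lambda>\<^sub>1 ** C)" by (rule matrix_mul_assoc)
    finally show ?thesis by (simp only: CLTS matrix_mul_lid)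
  qed
  have exp_C: "mat_exp (- y *\<^sub>R \<Lambda>\<^sub>1) ** C = C ** mat_exp (- y *\<^sub>R \<Lambda>\<^sub>2)" for y
    by (intro mat_exp_intertwine)
      (simp add: C\<Lambda> bounded_bilinear.scaleR_left[OF bounded_bilinear_matrix_mult]
        bounded_bilinear.scaleR_right[OF bounded_bilinear_matrix_mult]
        bounded_bilinear.minus_left[OF bounded_bilinear_matrix_mult]
        bounded_bilinear.minus_right[OF bounded_bilinear_matrix_mult])
  \<comment> \<open>Multiplication by \<open>L\<close> makes the solution matrix square, so that
    determinants apply. The limit of \<open>d y * (det B * det C)\<close> is then computed twice,
    from the normalizations of \<open>Z\<^sub>2\<close> and of \<open>Z\<^sub>1\<close>.\<close>
  define d where "d y = det (L ** Z\<^sub>2 y ** mat_exp (- y *\<^sub>R \<Lambda>\<^sub>2))" for y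
  have "((\<lambda>y. L ** (Z\<^sub>2 y ** mat_exp (- y *\<^sub>R \<Lambda>\<^sub>2))) \<longlongrightarrow> L ** S\<^sub>2) F"
    by (intro tendsto_matrix_mult tendsto_const L2)
  from tendsto_det[OF this] have "(d \<longlongrightarrow> 1) F"
    by (simp add: d_def[abs_def] matrix_mul_assoc L)
  then have lim1: "((\<lambda>y. d y * (det B * det C)) \<longlongrightarrow> 1 * (det B * det C)) F"
    by (intro tendsto_mult tendsto_const)
  have lim2: "((\<lambda>y. d y * (det B * det C)) \<longlongrightarrow> 1) F"
  proof -
    have "((\<lambda>y. L ** (T y ** (Z\<^sub>1 y ** mat_exp (- y *\<^sub>R \<Lambda>\<^sub>1)) ** C)) \<longlongrightarrow> L ** (T\<^sub>0 ** S\<^sub>1 ** C)) F"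
      by (intro tendsto_matrix_mult tendsto_const L1 T)
    moreover have "L ** (T y ** (Z\<^sub>1 y ** mat_exp (- y *\<^sub>R \<Lambda>\<^sub>1)) ** C)
        = L ** Z\<^sub>2 y ** B ** C ** mat_exp (- y *\<^sub>R \<Lambda>\<^sub>2)" for y
    proof -
      have "L ** (T y ** (Z\<^sub>1 y ** mat_exp (- y *\<^sub>R \<Lambda>\<^sub>1)) ** C)
          = L ** (T y ** Z\<^sub>1 y) ** (mat_exp (- y *\<^sub>R \<Lambda>\<^sub>1) ** C)"
        by (simp only: matrix_mul_assoc)
      also have "\<dots> = L ** Z\<^sub>2 y ** B ** C ** mat_exp (- y *\<^sub>R \<Lambda>\<^sub>2)"
        by (simp only: B exp_C) (simp only: matrix_mul_assoc)
      finally show ?thesis .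
    qed
    ultimately have "((\<lambda>y. L ** Z\<^sub>2 y ** B ** C ** mat_exp (- y *\<^sub>R \<Lambda>\<^sub>2)) \<longlongrightarrow> mat 1) F"
      using L by (simp only: S2(1))
    from tendsto_det[OF this] show ?thesis by (simp add: d_def[abs_def] det_mul mult_ac)
  qed
  have "det B * det C = 1"
    using tendsto_unique[OF F lim1 lim2] by simp
  with B that show ?thesis by blast
qed

lemma det_adjoin_column_mult:
  fixes T :: "complex^3^3" and X X' :: "complex^2^3" and x x' :: "complex^1^3"
  assumes X: "T ** X = X' ** B" and x: "T ** x = x' ** b"
  shows "det T * det (\<chi> i. vector [X $ i $ 1, X $ i $ 2, x $ i $ 1] :: complex^3^3)
    = det (\<chi> i. vector [X' $ i $ 1, X' $ i $ 2, x' $ i $ 1] :: complex^3^3) * (det B * det b)"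
proof -
  \<comment> \<open>The two families of solutions are not mixed, so the joint change of basis is
    block diagonal with blocks \<open>B\<close> and \<open>b\<close>.\<close>
  define C :: "complex^3^3" where
    "C = vector [vector [B $ 1 $ 1, B $ 1 $ 2, 0], vector [B $ 2 $ 1, B $ 2 $ 2, 0],
      vector [0, 0, b $ 1 $ 1]]"
  have X_entry: "(T ** X) $ i $ j = (X' ** B) $ i $ j"
    and x_entry: "(T ** x) $ i $ k = (x' ** b) $ i $ k" for i j k
    by (simp_all only: X x)
  have "(T ** (\<chi> i. vector [X $ i $ 1, X $ i $ 2, x $ i $ 1])) $ i $ j
      = ((\<chi> i. vector [X' $ i $ 1, X' $ i $ 2, x' $ i $ 1]) ** C) $ i $ j" for i j
    using exhaust_3[of j] X_entry[of i 1] X_entry[of i 2] x_entry[of i 1]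
    by (auto simp: C_def matrix_matrix_mult_def sum_3 sum_2 sum_1)
  then have "T ** (\<chi> i. vector [X $ i $ 1, X $ i $ 2, x $ i $ 1])
      = (\<chi> i. vector [X' $ i $ 1, X' $ i $ 2, x' $ i $ 1]) ** C"
    by (simp only: vec_eq_iff) simp
  from arg_cong[OF this, of det] show ?thesis
    by (simp add: det_mul C_def det_3[of C, unfolded C_def] det_2 det_1 algebra_simps)
qed

lemma evans_function_conjugate:
  fixes T :: "real \<Rightarrow> complex \<Rightarrow> complex^3^3"
  assumes E1: "evans_function M\<^sub>1 D\<^sub>1" and E2: "evans_function M\<^sub>2 D\<^sub>2"
    and T': "\<And>\<mu> y. \<mu> \<in> evans_region \<Longrightarrow> ((\<lambda>y. T y \<mu>) has_vector_derivative
      M\<^sub>2 y \<mu> ** T y \<mu> - T y \<mu> ** M\<^sub>1 y \<mu>) (at y)"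
    and Tp: "\<And>\<mu>. \<mu> \<in> evans_region \<Longrightarrow> ((\<lambda>y. T y \<mu>) \<longlongrightarrow> T\<^sub>p) at_top" "det T\<^sub>p \<noteq> 0"
    and Tm: "\<And>\<mu>. \<mu> \<in> evans_region \<Longrightarrow> ((\<lambda>y. T y \<mu>) \<longlongrightarrow> T\<^sub>m) at_bot" "det T\<^sub>m \<noteq> 0"
  obtains c where "c \<noteq> 0" "\<And>\<mu>. \<mu> \<in> evans_region \<Longrightarrow> D\<^sub>2 \<mu> = c * det (T 0 \<mu>) * D\<^sub>1 \<mu>"
proof -
  obtain Np1 Nm1 Sp1 Sm1 where
      K1: "kato_basis Np1 stable (Sp1 :: complex \<Rightarrow> complex^2^3)"
        "kato_basis Nm1 unstable (Sm1 :: complex \<Rightarrow> complex^1^3)"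
      and N1: "\<And>\<mu>. \<mu> \<in> evans_region \<Longrightarrow> ((\<lambda>y. M\<^sub>1 y \<mu>) \<longlongrightarrow> Np1 \<mu>) at_top"
        "\<And>\<mu>. \<mu> \<in> evans_region \<Longrightarrow> ((\<lambda>y. M\<^sub>1 y \<mu>) \<longlongrightarrow> Nm1 \<mu>) at_bot"
      and Z1: "\<And>\<mu>. \<mu> \<in> evans_region \<Longrightarrow> \<exists>Zp Zm.
        decaying_basis (\<lambda>y. M\<^sub>1 y \<mu>) (Np1 \<mu>) at_top (Sp1 \<mu>) Zp \<and>
        decaying_basis (\<lambda>y. M\<^sub>1 y \<mu>) (Nm1 \<mu>) at_bot (Sm1 \<mu>) Zm \<and>
        D\<^sub>1 \<mu> = det (\<chi> i. vector [Zp 0 $ i $ 1, Zp 0 $ i $ 2, Zm 0 $ i $ 1] :: complex^3^3)"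
    using E1 unfolding evans_function_def by blast
  obtain Np2 Nm2 Sp2 Sm2 where
      K2: "kato_basis Np2 stable (Sp2 :: complex \<Rightarrow> complex^2^3)"
        "kato_basis Nm2 unstable (Sm2 :: complex \<Rightarrow> complex^1^3)"
      and N2: "\<And>\<mu>. \<mu> \<in> evans_region \<Longrightarrow> ((\<lambda>y. M\<^sub>2 y \<mu>) \<longlongrightarrow> Np2 \<mu>) at_top"
        "\<And>\<mu>. \<mu> \<in> evans_region \<Longrightarrow> ((\<lambda>y. M\<^sub>2 y \<mu>) \<longlongrightarrow> Nm2 \<mu>) at_bot"
      and Z2: "\<And>\<mu>. \<mu> \<in> evans_region \<Longrightarrow> \<exists>Zp Zm.
        decaying_basis (\<lambda>y. M\<^sub>2 y \<mu>) (Np2 \<mu>) at_top (Sp2 \<mu>) Zp \<and>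
        decaying_basis (\<lambda>y. M\<^sub>2 y \<mu>) (Nm2 \<mu>) at_bot (Sm2 \<mu>) Zm \<and>
        D\<^sub>2 \<mu> = det (\<chi> i. vector [Zp 0 $ i $ 1, Zp 0 $ i $ 2, Zm 0 $ i $ 1] :: complex^3^3)"
    using E2 unfolding evans_function_def by blast
  \<comment> \<open>The derivative of \<open>T\<close> converges to
    \<open>N\<^sub>2 ** T\<^sub>0 - T\<^sub>0 ** N\<^sub>1\<close>; since \<open>T\<close> itself
    converges, this limit is 0.\<close>
  have intertwine: "N\<^sub>2 ** T\<^sub>0 = T\<^sub>0 ** N\<^sub>1"
    if \<mu>: "\<mu> \<in> evans_region" and F: "F = at_top \<or> F = at_bot"
      and lim: "((\<lambda>y. T y \<mu>) \<longlongrightarrow> T\<^sub>0) F" "((\<lambda>y. M\<^sub>1 y \<mu>) \<longlongrightarrow> N\<^sub>1) F" "((\<lambda>y. M\<^sub>2 y \<mu>) \<longlongrightarrow> N\<^sub>2) F"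
    for \<mu> F N\<^sub>1 N\<^sub>2 T\<^sub>0
  proof -
    have "((\<lambda>y. M\<^sub>2 y \<mu> ** T y \<mu> - T y \<mu> ** M\<^sub>1 y \<mu>) \<longlongrightarrow> N\<^sub>2 ** T\<^sub>0 - T\<^sub>0 ** N\<^sub>1) F"
      by (intro tendsto_diff tendsto_matrix_mult lim)
    from tendsto_derivative_zero[OF F lim(1) T'[OF \<mu>] this] show ?thesis by simp
  qed
  have NTp: "Np2 \<mu> ** T\<^sub>p = T\<^sub>p ** Np1 \<mu>" if \<mu>: "\<mu> \<in> evans_region" for \<mu>
    by (rule intertwine[OF \<mu> _ Tp(1)[OF \<mu>] N1(1)[OF \<mu>] N2(1)[OF \<mu>]]) (rule disjI1, rule refl)
  have NTm: "Nm2 \<mu> ** T\<^sub>m = T\<^sub>m ** Nm1 \<mu>" if \<mu>: "\<mu> \<in> evans_region" for \<mu>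
    by (rule intertwine[OF \<mu> _ Tm(1)[OF \<mu>] N1(2)[OF \<mu>] N2(2)[OF \<mu>]]) (rule disjI2, rule refl)
  obtain Cp where Cp: "det Cp \<noteq> 0" "\<And>\<mu>. \<mu> \<in> evans_region \<Longrightarrow> Sp2 \<mu> = T\<^sub>p ** Sp1 \<mu> ** Cp"
    using kato_basis_conjugate[OF K1(1) K2(1) NTp Tp(2)] by blast
  obtain Cm where Cm: "det Cm \<noteq> 0" "\<And>\<mu>. \<mu> \<in> evans_region \<Longrightarrow> Sm2 \<mu> = T\<^sub>m ** Sm1 \<mu> ** Cm"
    using kato_basis_conjugate[OF K1(2) K2(2) NTm Tm(2)] by blast
  have "D\<^sub>2 \<mu> = (det Cp * det Cm) * det (T 0 \<mu>) * D\<^sub>1 \<mu>" if \<mu>: "\<mu> \<in> evans_region" for \<mu>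
  proof -
    obtain Zp1 Zm1 where
        p1: "decaying_basis (\<lambda>y. M\<^sub>1 y \<mu>) (Np1 \<mu>) at_top (Sp1 \<mu>) Zp1"
        and m1: "decaying_basis (\<lambda>y. M\<^sub>1 y \<mu>) (Nm1 \<mu>) at_bot (Sm1 \<mu>) Zm1"
        and D1: "D\<^sub>1 \<mu> = det (\<chi> i. vector [Zp1 0 $ i $ 1, Zp1 0 $ i $ 2, Zm1 0 $ i $ 1] :: complex^3^3)"
      using Z1[OF \<mu>] by blast
    obtain Zp2 Zm2 where
        p2: "decaying_basis (\<lambda>y. M\<^sub>2 y \<mu>) (Np2 \<mu>) at_top (Sp2 \<mu>) Zp2"
        and m2: "decaying_basis (\<lambda>y. M\<^sub>2 y \<mu>) (Nm2 \<mu>) at_bot (Sm2 \<mu>) Zm2"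
        and D2: "D\<^sub>2 \<mu> = det (\<chi> i. vector [Zp2 0 $ i $ 1, Zp2 0 $ i $ 2, Zm2 0 $ i $ 1] :: complex^3^3)"
      using Z2[OF \<mu>] by blast
    have inj: "inj ((*v) (Sp2 \<mu>))" "inj ((*v) (Sm2 \<mu>))"
      using K2 \<mu> unfolding kato_basis_def bij_betw_def by blast+
    obtain Bp where Bp: "\<And>y. T y \<mu> ** Zp1 y = Zp2 y ** Bp" "det Bp * det Cp = 1"
      using decaying_basis_conjugate[OF trivial_limit_at_top_linorder T'[OF \<mu>] Tp(1)[OF \<mu>]
          NTp[OF \<mu>] p1 p2 Cp(2)[OF \<mu>] inj(1)] by blast
    obtain Bm where Bm: "\<And>y. T y \<mu> ** Zm1 y = Zm2 y ** Bm" "det Bm * det Cm = 1"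
      using decaying_basis_conjugate[OF trivial_limit_at_bot_linorder T'[OF \<mu>] Tm(1)[OF \<mu>]
          NTm[OF \<mu>] m1 m2 Cm(2)[OF \<mu>] inj(2)] by blast
    have "det (T 0 \<mu>) * D\<^sub>1 \<mu> = D\<^sub>2 \<mu> * (det Bp * det Bm)"
      unfolding D1 D2 by (rule det_adjoin_column_mult[OF Bp(1) Bm(1)])
    \<comment> \<open>\<open>det Bp\<close> and \<open>det Bm\<close> are the reciprocals of
      \<open>det Cp\<close> and \<open>det Cm\<close>, hence independent of \<mu>.\<close>
    then have "(det Cp * det Cm) * (det (T 0 \<mu>) * D\<^sub>1 \<mu>)
        = D\<^sub>2 \<mu> * ((det Bp * det Cp) * (det Bm * det Cm))"
      by (simp only: mult_ac)
    then show ?thesis by (simp add: Bp(2) Bm(2) mult.assoc)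
  qed
  with that[of "det Cp * det Cm"] Cp(1) Cm(1) show ?thesis by simp
qed

subsection \<open>The profile in Lagrangian coordinates\<close>

text \<open>By L'Hospital's rule \<open>f x / x\<close> tends to \<open>c\<close>, so
  \<open>f\<close> grows linearly. This serves for \<open>lag_coord\<close>, whose derivative is the
  density.\<close>

lemma filterlim_at_top_of_derivative_limit:
  fixes f f' :: "real \<Rightarrow> real"
  assumes "\<And>x. (f has_real_derivative f' x) (at x)" "(f' \<longlongrightarrow> c) at_top" "c > 0"
  shows "filterlim f at_top at_top"
proof -
  have "((\<lambda>x. f x / x) \<longlongrightarrow> c) at_top"
    by (rule lhospital_at_top_at_top[where f' = f' and g' = "\<lambda>_. 1"])
      (use assms in \<open>auto intro: filterlim_ident\<close>)
  then have "filterlim (\<lambda>x. f x / x * x) at_top at_top"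
    by (rule filterlim_tendsto_pos_mult_at_top) (use assms in \<open>auto intro: filterlim_ident\<close>)
  moreover have "\<forall>\<^sub>F x in at_top. f x / x * x = f x"
    using eventually_gt_at_top[of "0::real"] by eventually_elim simp
  ultimately show ?thesis by (simp add: filterlim_cong)
qed

lemma filterlim_at_bot_of_derivative_limit:
  fixes f f' :: "real \<Rightarrow> real"
  assumes "\<And>x. (f has_real_derivative f' x) (at x)" "(f' \<longlongrightarrow> c) at_bot" "c > 0"
  shows "filterlim f at_bot at_bot"
proof -
  have "filterlim (\<lambda>x. - f (- x)) at_top at_top"
  proof (rule filterlim_at_top_of_derivative_limit)
    show "((\<lambda>x. - f (- x)) has_real_derivative f' (- x)) (at x)" for x
      using DERIV_minus[of "\<lambda>x. f (- x)"] assms(1)[of "- x"] by (fastforce simp: DERIV_mirror)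
    show "((\<lambda>x. f' (- x)) \<longlongrightarrow> c) at_top"
      using assms(2) by (simp add: filterlim_at_bot_mirror)
  qed (fact assms)
  then show ?thesis by (simp add: filterlim_at_bot_mirror filterlim_uminus_at_bot)
qed

lemma lag_coord_derivative:
  assumes "continuous_on UNIV \<rho>"
  shows "(lag_coord \<rho> has_real_derivative \<rho> x) (at x)"
proof -
  \<comment> \<open>The interval has 0 and \<open>x\<close> in its interior, so the derivative
    within it is a full derivative.\<close>
  define b where "b = \<bar>x\<bar> + 1"
  have "((\<lambda>x. LBINT z=0..x. \<rho> z) has_vector_derivative \<rho> x) (at x within {-b..b})"
    using interval_integral_FTC2[of "- b" 0 b \<rho> x] continuous_on_subset[OF assms]
    by (simp add: b_def zero_ereal_def)
  moreover have "at x within {-b..b} = at x"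
    by (rule at_within_interior) (auto simp: b_def abs_if)
  ultimately show ?thesis
    by (simp add: has_real_derivative_iff_has_vector_derivative lag_coord_def[abs_def])
qed

text \<open>Inserting \<open>\<rho> = 1 / u\<close> turns the momentum flux into a function of
  \<open>u\<close> alone, and the momentum equation into a second-order equation for
  \<open>u\<close>.\<close>

lemma shock_profile_derivatives:
  assumes "shock_profile a \<gamma> \<rho> u"
  shows shock_profile_velocity_pos: "u x > 0"
    and shock_profile_density: "\<rho> x = 1 / u x"
    and shock_profile_deriv: "(u has_real_derivative deriv u x) (at x)"
    and shock_profile_deriv2: "(deriv u has_real_derivative
        (1 - a * \<gamma> * u x powr (- \<gamma> - 1)) * deriv u x) (at x)"
proof -
  have *: "\<rho> x > 0" "\<rho> x * u x = 1" for x
    using assms by (auto simp: shock_profile_def)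
  show pos: "u x > 0" for x
    using *[of x] by (metis less_eq_real_def mult_less_cancel_left_pos mult_zero_right zero_less_one)
  show \<rho>: "\<rho> x = 1 / u x" for x
    using *(2)[of x] pos[of x] by (simp add: field_simps)
  show du: "(u has_real_derivative deriv u x) (at x)" for x
    using assms by (simp add: shock_profile_def DERIV_deriv_iff_real_differentiable)
  have flux: "(\<lambda>z. \<rho> z * (u z)\<^sup>2 + pressure a \<gamma> (\<rho> z)) = (\<lambda>z. u z + a * u z powr (- \<gamma>))"
    using pos by (auto simp: fun_eq_iff \<rho> pressure_def power2_eq_square powr_minus_divide powr_divide less_imp_le)
  have "((\<lambda>z. u z + a * u z powr (- \<gamma>)) has_real_derivative
      (1 - a * \<gamma> * u x powr (- \<gamma> - 1)) * deriv u x) (at x)"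
    using DERIV_add[OF du DERIV_cmult[OF DERIV_fun_powr[OF du pos, of "- \<gamma>"], of a]] by (simp add: algebra_simps)
  then have "deriv (deriv u) x = (1 - a * \<gamma> * u x powr (- \<gamma> - 1)) * deriv u x"
    using assms flux by (metis (no_types, lifting) DERIV_imp_deriv shock_profile_def)
  moreover have "(deriv u has_real_derivative deriv (deriv u) x) (at x)"
    using assms by (simp add: shock_profile_def DERIV_deriv_iff_real_differentiable)
  ultimately show "(deriv u has_real_derivative
        (1 - a * \<gamma> * u x powr (- \<gamma> - 1)) * deriv u x) (at x)" by simp
qed

lemma shock_profile_limit:
  assumes S: "shock_profile a \<gamma> \<rho> u" and F: "F = at_top \<or> F = at_bot"
  obtains v where "v > 0" "(u \<longlongrightarrow> v) F" "(deriv u \<longlongrightarrow> 0) F"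
proof -
  note u = shock_profile_derivatives[OF S]
  have nb: "F \<noteq> bot"
    using F by (elim disjE) (simp_all only: trivial_limit_at_top_linorder trivial_limit_at_bot_linorder not_False_eq_True)
  obtain r v where lim: "(\<rho> \<longlongrightarrow> r) F" "(u \<longlongrightarrow> v) F"
    using S F unfolding shock_profile_def by blast
  \<comment> \<open>Unit mass flux passes to the limit and keeps the limiting velocity away from
    0.\<close>
  have "((\<lambda>x. \<rho> x * u x) \<longlongrightarrow> r * v) F" by (intro tendsto_mult lim)
  moreover have "(\<lambda>x. \<rho> x * u x) = (\<lambda>x. 1)" using u(1,2) by (simp add: fun_eq_iff less_imp_neq[symmetric])
  ultimately have "r * v = 1" using nb by (simp add: tendsto_const_iff)
  moreover have "v \<ge> 0"
    by (rule tendsto_lowerbound[OF lim(2) _ nb]) (simp add: u(1) less_imp_le)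
  ultimately have v: "v > 0" by (cases "v = 0") auto
  text \<open>The integrated profile equation shows that \<open>deriv u\<close> converges.\<close>
  have "((\<lambda>z. deriv u z - (u z + a * u z powr (- \<gamma>))) has_real_derivative 0) (at x)" for x
    using DERIV_diff[OF u(4) DERIV_add[OF u(3) DERIV_cmult[OF DERIV_fun_powr[OF u(3) u(1), of "- \<gamma>"], of a]]]
    by (simp add: algebra_simps)
  then obtain K where K: "\<And>x. deriv u x - (u x + a * u x powr (- \<gamma>)) = K"
    using DERIV_isconst_all by blast
  have "((\<lambda>x. K + (u x + a * u x powr (- \<gamma>))) \<longlongrightarrow> K + (v + a * v powr (- \<gamma>))) F"
    using v by (intro tendsto_intros lim) auto
  moreover have "(\<lambda>x. K + (u x + a * u x powr (- \<gamma>))) = deriv u"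
    using K by (simp add: fun_eq_iff algebra_simps)
  ultimately have lim': "(deriv u \<longlongrightarrow> K + (v + a * v powr (- \<gamma>))) F" by simp
  have "K + (v + a * v powr (- \<gamma>)) = 0"
    by (rule tendsto_derivative_zero[OF F lim(2) _ lim'])
      (use u(3) in \<open>simp add: has_real_derivative_iff_has_vector_derivative\<close>)
  with lim' show ?thesis using that[OF v lim(2)] by simp
qed

text \<open>The density is positive with positive limits, so \<open>lag_coord\<close> is increasing
  and unbounded in both directions, hence a bijection; its inverse has derivative
  \<open>1 / \<rho> = u\<close>.\<close>

lemma shock_profile_coordinates:
  assumes S: "shock_profile a \<gamma> \<rho> u"
  shows eul_coord_derivative: "(eul_coord \<rho> has_real_derivative u (eul_coord \<rho> y)) (at y)"
    and eul_coord_at_top: "filterlim (eul_coord \<rho>) at_top at_top"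
    and eul_coord_at_bot: "filterlim (eul_coord \<rho>) at_bot at_bot"
proof -
  note u = shock_profile_derivatives[OF S]
  have \<rho>_pos: "\<rho> x > 0" for x by (simp add: u)
  have "continuous_on UNIV \<rho>"
    unfolding u(2) using u(1,3)
    by (intro continuous_intros continuous_at_imp_continuous_on ballI) (auto intro: DERIV_isCont simp: less_imp_neq[symmetric])
  note L = lag_coord_derivative[OF this]
  have mono: "strict_mono (lag_coord \<rho>)"
    by (rule strict_monoI, rule DERIV_pos_imp_increasing) (use L \<rho>_pos in blast)+
  have lim: "\<exists>c>0. (\<rho> \<longlongrightarrow> c) F" if F: "F = at_top \<or> F = at_bot" for F
  proof -
    obtain v where "v > 0" "(u \<longlongrightarrow> v) F" using shock_profile_limit[OF S F] .
    then have "((\<lambda>x. 1 / u x) \<longlongrightarrow> 1 / v) F" by (intro tendsto_intros) auto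
    with \<open>v > 0\<close> show ?thesis
      unfolding u(2) by (intro exI[of _ "1 / v"]) simp
  qed
  have top: "filterlim (lag_coord \<rho>) at_top at_top"
    using filterlim_at_top_of_derivative_limit[OF L] lim by blast
  have bot: "filterlim (lag_coord \<rho>) at_bot at_bot"
    using filterlim_at_bot_of_derivative_limit[OF L] lim by blast
  have cont: "continuous_on A (lag_coord \<rho>)" for A
    using L by (intro continuous_at_imp_continuous_on ballI DERIV_isCont)
  have "\<exists>x. lag_coord \<rho> x = y" for y
  proof -
    obtain x\<^sub>1 where 1: "lag_coord \<rho> x\<^sub>1 \<le> y"
      using bot unfolding filterlim_at_bot by (metis eventually_at_bot_linorder order_refl)
    obtain x\<^sub>2 where 2: "y \<le> lag_coord \<rho> x\<^sub>2"
      using top unfolding filterlim_at_top by (metis eventually_at_top_linorder order_refl)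
    have "x\<^sub>1 \<le> x\<^sub>2" using 1 2 strict_mono_less_eq[OF mono] by (metis order_trans)
    then show ?thesis using IVT'[OF 1 2 _ cont] by blast
  qed
  then have surj: "lag_coord \<rho> (eul_coord \<rho> y) = y" for y
    unfolding eul_coord_def by (metis surj_def surj_f_inv_f)
  have inv: "eul_coord \<rho> (lag_coord \<rho> x) = x" for x
    unfolding eul_coord_def by (simp add: strict_mono_imp_inj_on[OF mono])
  show "(eul_coord \<rho> has_real_derivative u (eul_coord \<rho> y)) (at y)"
  proof -
    \<comment> \<open>The derivative rule for inverse functions presupposes continuity of the
      inverse.\<close>
    have "isCont (eul_coord \<rho>) (lag_coord \<rho> (eul_coord \<rho> y))"
      by (rule isCont_inverse_function[where d = 1]) (auto simp: inv intro: DERIV_isCont[OF L])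
    then have "isCont (eul_coord \<rho>) y" by (simp only: surj)
    then have "(eul_coord \<rho> has_real_derivative inverse (\<rho> (eul_coord \<rho> y))) (at y)"
      by (intro has_field_derivative_inverse_basic[OF L _ _ open_UNIV UNIV_I] surj)
        (use \<rho>_pos[of "eul_coord \<rho> y"] in simp_all)
    then show ?thesis by (simp add: u(2))
  qed
  \<comment> \<open>Bounds on \<open>eul_coord\<close> become bounds on its argument, with
    \<open>lag_coord \<rho> x\<close> as the threshold.\<close>
  have le: "eul_coord \<rho> y \<le> x \<longleftrightarrow> y \<le> lag_coord \<rho> x" "x \<le> eul_coord \<rho> y \<longleftrightarrow> lag_coord \<rho> x \<le> y" for x y
    using strict_mono_less_eq[OF mono] surj by metis+
  show "filterlim (eul_coord \<rho>) at_top at_top" "filterlim (eul_coord \<rho>) at_bot at_bot"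
    unfolding filterlim_at_top filterlim_at_bot le
    by (auto simp: eventually_ge_at_top eventually_le_at_bot)
qed

text \<open>With unit mass flux the profiles of specific volume and velocity coincide. The
  derivatives are those of \<open>u\<close> and \<open>deriv u\<close>, transported by
  \<open>dx/dy = u\<close>.\<close>

lemma shock_profile_lagrangian:
  assumes S: "shock_profile a \<gamma> \<rho> u"
  defines "\<kappa> \<equiv> \<lambda>y. deriv u (eul_coord \<rho> y)" and "\<tau> \<equiv> tau_bar \<rho>"
  shows tau_bar_eq: "\<tau> y = u (eul_coord \<rho> y)"
    and w_bar_eq: "w_bar \<rho> u = \<tau>"
    and tau_bar_pos: "\<tau> y > 0"
    and tau_bar_derivative: "(\<tau> has_real_derivative \<kappa> y * \<tau> y) (at y)"
    and slope_derivative: "(\<kappa> has_real_derivative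
      \<tau> y * (1 - a * \<gamma> * \<tau> y powr (- \<gamma> - 1)) * \<kappa> y) (at y)"
    and tau_bar_limit: "F = at_top \<or> F = at_bot \<Longrightarrow> \<exists>v>0. (\<tau> \<longlongrightarrow> v) F \<and> (\<kappa> \<longlongrightarrow> 0) F"
proof -
  note u = shock_profile_derivatives[OF S] and X = shock_profile_coordinates[OF S]
  have \<tau>: "\<tau> = (\<lambda>y. u (eul_coord \<rho> y))"
    by (simp add: fun_eq_iff \<tau>_def tau_bar_def u)
  then show "\<tau> y = u (eul_coord \<rho> y)" "w_bar \<rho> u = \<tau>"
    by (simp_all add: w_bar_def[abs_def])
  show "\<tau> y > 0" by (simp add: \<tau> u)
  show "(\<tau> has_real_derivative \<kappa> y * \<tau> y) (at y)"
    unfolding \<tau> \<kappa>_def by (rule DERIV_chain2[OF u(3) X(1)])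
  show "(\<kappa> has_real_derivative \<tau> y * (1 - a * \<gamma> * \<tau> y powr (- \<gamma> - 1)) * \<kappa> y) (at y)"
    using DERIV_chain2[OF u(4) X(1)] unfolding \<tau> \<kappa>_def by (simp add: mult_ac)
  assume F: "F = at_top \<or> F = at_bot"
  then have XF: "filterlim (eul_coord \<rho>) F F" using X(2,3) by auto
  obtain v where "v > 0" "(u \<longlongrightarrow> v) F" "(deriv u \<longlongrightarrow> 0) F" using shock_profile_limit[OF S F] .
  then show "\<exists>v>0. (\<tau> \<longlongrightarrow> v) F \<and> (\<kappa> \<longlongrightarrow> 0) F"
    unfolding \<tau> \<kappa>_def using filterlim_compose[OF _ XF] by blast
qed

subsection \<open>The conjugating matrix\<close>

text \<open>
  The Lagrangian displacement of a mode is \<open>\<xi> = (w - \<tau>) / \<mu>\<close>, because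
  \<open>\<xi>' = \<tau>\<close> and \<open>(\<mu> \<xi> + \<tau> - w)' = 0\<close>.  Hence the Eulerian perturbation of the velocity
  is \<open>w - \<kappa> \<xi>\<close> with \<open>\<kappa>\<close> the slope \<open>du/dx\<close> of the profile, and similarly for the
  density; substituting these into \<open>(f\<^sub>1, f\<^sub>2, u)\<close> gives the matrix below.
\<close>
definition lag_to_eul :: "real \<Rightarrow> real \<Rightarrow> real \<Rightarrow> complex \<Rightarrow> complex^3^3" where
  "lag_to_eul t k \<alpha> \<mu> =
     (let t = complex_of_real t; k = complex_of_real k; \<alpha> = complex_of_real \<alpha>
      in vector [vector [1 / t, - 1 / t, 0],
                 vector [1 + \<alpha>, - 2, 1 / t],
                 vector [k / \<mu>, 1 - k / \<mu>, 0]])"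

text \<open>Expanding along the third column leaves a minor in which the terms
  \<open>k / \<mu>\<close> cancel, so the determinant does not depend on \<mu>.\<close>

lemma det_lag_to_eul: "det (lag_to_eul t k \<alpha> \<mu>) = - 1 / (complex_of_real t)\<^sup>2"
  by (simp add: lag_to_eul_def Let_def det_3 power2_eq_square left_diff_distrib diff_divide_distrib)

text \<open>In the limit \<mu> occurs only in \<open>0 / \<mu>\<close>; the last argument 1 is a
  placeholder that makes the limit visibly the same for all \<mu>.\<close>

lemma tendsto_lag_to_eul:
  assumes "(t \<longlongrightarrow> t\<^sub>0) F" "t\<^sub>0 \<noteq> 0" "(k \<longlongrightarrow> 0) F" "(\<alpha> \<longlongrightarrow> \<alpha>\<^sub>0) F" "\<mu> \<noteq> 0"
  shows "((\<lambda>y. lag_to_eul (t y) (k y) (\<alpha> y) \<mu>) \<longlongrightarrow> lag_to_eul t\<^sub>0 0 \<alpha>\<^sub>0 1) F"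
proof -
  have "((\<lambda>y. complex_of_real (k y) / \<mu>) \<longlongrightarrow> of_real 0 / \<mu>) F"
    "((\<lambda>y. 1 - complex_of_real (k y) / \<mu>) \<longlongrightarrow> 1 - of_real 0 / \<mu>) F"
    using assms by (intro tendsto_intros; simp)+
  moreover have "((\<lambda>y. 1 / complex_of_real (t y)) \<longlongrightarrow> 1 / of_real t\<^sub>0) F"
    "((\<lambda>y. - 1 / complex_of_real (t y)) \<longlongrightarrow> - 1 / of_real t\<^sub>0) F"
    "((\<lambda>y. 1 + complex_of_real (\<alpha> y)) \<longlongrightarrow> 1 + of_real \<alpha>\<^sub>0) F"
    using assms by (intro tendsto_intros; simp)+
  ultimately show ?thesis
    by (simp add: tendsto_matrix_iff forall_3 lag_to_eul_def Let_def)
qed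

lemma lag_to_eul_derivative:
  assumes t: "(t has_real_derivative t') (at y)" "t y \<noteq> 0"
    and k: "(k has_real_derivative k') (at y)" and \<alpha>: "(\<alpha> has_real_derivative \<alpha>') (at y)"
  shows "((\<lambda>y. lag_to_eul (t y) (k y) (\<alpha> y) \<mu>) has_vector_derivative
    vector [vector [of_real (- t' / (t y)\<^sup>2), of_real (t' / (t y)\<^sup>2), 0],
            vector [of_real \<alpha>', 0, of_real (- t' / (t y)\<^sup>2)],
            vector [of_real k' / \<mu>, - of_real k' / \<mu>, 0]]) (at y)"
    (is "(_ has_vector_derivative ?D) _")
proof -
  have r: "((\<lambda>y. complex_of_real (1 / t y)) has_vector_derivative of_real (- t' / (t y)\<^sup>2)) (at y)"
    using DERIV_divide[OF DERIV_const t, of 1]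
    by (intro has_vector_derivative_of_real) (simp add: power2_eq_square)
  have k: "((\<lambda>y. complex_of_real (k y) / \<mu>) has_vector_derivative of_real k' / \<mu>) (at y)"
    using bounded_linear.has_vector_derivative[OF bounded_linear_divide has_vector_derivative_of_real[OF k]] .
  note \<alpha> = has_vector_derivative_of_real[OF \<alpha>, where 'a = complex]
  have "\<forall>i j. ((\<lambda>y. lag_to_eul (t y) (k y) (\<alpha> y) \<mu> $ i $ j) has_vector_derivative
      ?D $ i $ j) (at y)"
    using r k has_vector_derivative_add[OF has_vector_derivative_const \<alpha>, of 1]
      has_vector_derivative_minus[OF r]
      has_vector_derivative_diff[OF has_vector_derivative_const k, of 1]
    by (simp add: forall_3 lag_to_eul_def Let_def)
  then show ?thesis by (intro has_vector_derivative_vec) blast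
qed

text \<open>At density \<open>1 / \<tau>\<close> the derivative of the pressure is
  \<open>\<tau>\<^sup>2 * P\<close>, so \<beta> is \<open>\<tau> * (1 + P)\<close>.\<close>

lemma pseudo_lagrangian_matrix_explicit:
  assumes S: "shock_profile a \<gamma> \<rho> u"
  shows "pseudo_lagrangian_matrix a \<gamma> \<rho> u y \<mu> =
    (let t = complex_of_real (tau_bar \<rho> y);
         P = complex_of_real (a * \<gamma> * tau_bar \<rho> y powr (- \<gamma> - 1))
     in vector [vector [- \<mu>, 0, - \<mu> / t],
                vector [- \<mu> * t, 0, 0],
                vector [- (t\<^sup>2 * (1 + P)), t, t * (1 - P)]])"
proof -
  define x where "x = eul_coord \<rho> y"
  have \<tau>: "tau_bar \<rho> y = u x" by (simp add: x_def shock_profile_lagrangian(1)[OF S])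
  have pos: "u x > 0" and \<rho>: "\<rho> x = 1 / u x" using shock_profile_derivatives[OF S] by auto
  have "(pressure a \<gamma> has_real_derivative a * (\<gamma> * \<rho> x powr (\<gamma> - 1))) (at (\<rho> x))"
    unfolding pressure_def[abs_def] using pos
    by (intro DERIV_cmult has_real_derivative_powr) (simp add: \<rho>)
  then have "deriv (pressure a \<gamma>) (\<rho> x) = a * (\<gamma> * (1 / u x) powr (\<gamma> - 1))"
    by (simp add: DERIV_imp_deriv \<rho>)
  also have "(1 / u x) powr (\<gamma> - 1) = (u x)\<^sup>2 * u x powr (- \<gamma> - 1)"
  proof -
    have "(1 / u x) powr (\<gamma> - 1) = u x powr (2 + (- \<gamma> - 1))"
      using pos by (simp add: powr_divide powr_minus_divide[symmetric])
    also have "\<dots> = u x powr 2 * u x powr (- \<gamma> - 1)" by (rule powr_add)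
    finally show ?thesis using pos by simp
  qed
  finally have \<beta>: "eul_beta a \<gamma> \<rho> u x = u x * (1 + a * \<gamma> * u x powr (- \<gamma> - 1))"
    using pos by (simp add: eul_beta_def power2_eq_square field_simps)
  have nz: "complex_of_real (u x) \<noteq> 0" using pos by simp
  show ?thesis
    unfolding pseudo_lagrangian_matrix_def eulerian_matrix_def \<tau> x_def[symmetric] \<beta> \<rho>
    using nz by (simp add: Let_def vec_eq_iff forall_3)
      (simp add: scaleR_conv_of_real power2_eq_square field_simps)
qed

text \<open>The algebraic core of the conjugation: the right-hand side is the derivative of
  \<open>T\<close> with \<open>k * t\<close> for the derivative of \<open>t\<close> and
  \<open>t * (1 - P) * k\<close> for that of \<open>k\<close>, as the profile equation prescribes.
  \<open>k * t / t\<close> is left unreduced to match the entry of the Lagrangian matrix.\<close>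

lemma lag_to_eul_intertwine:
  fixes t k P \<alpha>' \<mu> :: complex
  assumes "t \<noteq> 0" "\<mu> \<noteq> 0" "\<alpha> = P - k / t"
  defines "T \<equiv> vector [vector [1 / t, - 1 / t, 0], vector [1 + \<alpha>, - 2, 1 / t],
      vector [k / \<mu>, 1 - k / \<mu>, 0]] :: complex^3^3"
  shows "vector [vector [- \<mu>, 0, - \<mu> / t], vector [- \<mu> * t, 0, 0],
        vector [- (t\<^sup>2 * (1 + P)), t, t * (1 - P)]] ** T
      - T ** vector [vector [- \<mu>, 0, 1], vector [0, 0, 1],
        vector [\<mu> * \<alpha> * t - t * \<alpha>', \<mu> * t, t * (1 - \<alpha>) + k * t / t]]
      = (vector [vector [- (k * t) / t\<^sup>2, k * t / t\<^sup>2, 0], vector [\<alpha>', 0, - (k * t) / t\<^sup>2],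
        vector [t * (1 - P) * k / \<mu>, - (t * (1 - P) * k) / \<mu>, 0]] :: complex^3^3)"
  using assms(1,2)
  by (simp add: T_def assms(3) vec_eq_iff forall_3 matrix_matrix_mult_def sum_3 power2_eq_square)
    (simp add: field_simps)

theorem proposition5p1:
  fixes a \<gamma> :: real and \<rho> u :: "real \<Rightarrow> real" and D\<^sub>p\<^sub>L D\<^sub>L :: "complex \<Rightarrow> complex"
  assumes "a > 0" and "\<gamma> > 0"
    and "shock_profile a \<gamma> \<rho> u"
    and "evans_function (pseudo_lagrangian_matrix a \<gamma> \<rho> u) D\<^sub>p\<^sub>L"
    and "evans_function (lagrangian_matrix a \<gamma> (tau_bar \<rho>) (w_bar \<rho> u)) D\<^sub>L"
  shows "\<exists>C. C \<noteq> 0 \<and> (\<forall>\<mu>\<in>evans_region. D\<^sub>p\<^sub>L \<mu> = C * D\<^sub>L \<mu>)"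
proof -
  define \<tau> where "\<tau> = tau_bar \<rho>"
  define \<kappa> where "\<kappa> y = deriv u (eul_coord \<rho> y)" for y
  define P where "P y = a * \<gamma> * \<tau> y powr (- \<gamma> - 1)" for y
  define \<alpha> where "\<alpha> = lag_alpha a \<gamma> \<tau> \<tau>"
  define T where "T y \<mu> = lag_to_eul (\<tau> y) (\<kappa> y) (\<alpha> y) \<mu>" for y \<mu>
  note lag = shock_profile_lagrangian[OF assms(3), folded \<tau>_def \<kappa>_def[abs_def], folded \<kappa>_def]
  have w: "w_bar \<rho> u = \<tau>" and pos: "\<tau> y > 0"
    and d\<tau>: "(\<tau> has_real_derivative \<kappa> y * \<tau> y) (at y)"
    and d\<kappa>: "(\<kappa> has_real_derivative \<tau> y * (1 - P y) * \<kappa> y) (at y)"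
    and lim: "F = at_top \<or> F = at_bot \<Longrightarrow> \<exists>v>0. (\<tau> \<longlongrightarrow> v) F \<and> (\<kappa> \<longlongrightarrow> 0) F" for y F
    using lag(2-) by (simp_all add: P_def)
  have \<tau>': "deriv \<tau> y = \<kappa> y * \<tau> y" for y
    using d\<tau> by (rule DERIV_imp_deriv)
  \<comment> \<open>As \<open>w_bar\<close> equals \<tau>, its slope is
    \<open>\<kappa> * \<tau>\<close>, and division by the square of \<tau> leaves
    \<open>\<kappa> / \<tau>\<close>.\<close>
  have \<alpha>_eq: "\<alpha> y = P y - \<kappa> y / \<tau> y" for y
    using pos[of y] by (simp add: \<alpha>_def lag_alpha_def P_def \<tau>' power2_eq_square)
  have "\<exists>d. (\<alpha> has_real_derivative d) (at y)" for y
  proof -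
    have \<alpha>: "\<alpha> = (\<lambda>y. a * \<gamma> * \<tau> y powr (- \<gamma> - 1) - \<kappa> y / \<tau> y)"
      by (simp add: fun_eq_iff \<alpha>_eq P_def)
    show ?thesis unfolding \<alpha>
      by (rule exI DERIV_diff DERIV_cmult DERIV_fun_powr DERIV_divide d\<tau> d\<kappa> pos)+ (use pos[of y] in simp)
  qed
  then have d\<alpha>: "(\<alpha> has_real_derivative deriv \<alpha> y) (at y)" for y
    by (metis DERIV_imp_deriv)
  have T': "((\<lambda>y. T y \<mu>) has_vector_derivative pseudo_lagrangian_matrix a \<gamma> \<rho> u y \<mu> ** T y \<mu>
      - T y \<mu> ** lagrangian_matrix a \<gamma> \<tau> \<tau> y \<mu>) (at y)" if \<mu>: "\<mu> \<in> evans_region" for \<mu> y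
  proof -
    have nz: "complex_of_real (\<tau> y) \<noteq> 0" "\<mu> \<noteq> 0"
      using pos[of y] \<mu> by (simp_all add: evans_region_def)
    have \<alpha>c: "complex_of_real (\<alpha> y) = of_real (P y) - of_real (\<kappa> y) / of_real (\<tau> y)"
      by (simp add: \<alpha>_eq)
    have "pseudo_lagrangian_matrix a \<gamma> \<rho> u y \<mu> ** T y \<mu> - T y \<mu> ** lagrangian_matrix a \<gamma> \<tau> \<tau> y \<mu>
      = vector [vector [of_real (- (\<kappa> y * \<tau> y) / (\<tau> y)\<^sup>2), of_real (\<kappa> y * \<tau> y / (\<tau> y)\<^sup>2), 0],
            vector [of_real (deriv \<alpha> y), 0, of_real (- (\<kappa> y * \<tau> y) / (\<tau> y)\<^sup>2)],
            vector [of_real (\<tau> y * (1 - P y) * \<kappa> y) / \<mu>, - of_real (\<tau> y * (1 - P y) * \<kappa> y) / \<mu>, 0]]"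
      using lag_to_eul_intertwine[OF nz \<alpha>c, of "of_real (deriv \<alpha> y)"]
      unfolding T_def lag_to_eul_def lagrangian_matrix_def Let_def \<alpha>_def[symmetric] \<tau>'
        pseudo_lagrangian_matrix_explicit[OF assms(3)] \<tau>_def[symmetric] P_def[symmetric]
      by simp
    then show ?thesis
      using lag_to_eul_derivative[OF d\<tau> _ d\<kappa> d\<alpha>, of y \<mu>] pos[of y] by (simp add: T_def)
  qed
  have limit: "\<exists>T\<^sub>0. det T\<^sub>0 \<noteq> 0 \<and> (\<forall>\<mu>\<in>evans_region. ((\<lambda>y. T y \<mu>) \<longlongrightarrow> T\<^sub>0) F)"
    if F: "F = at_top \<or> F = at_bot" for F
  proof -
    obtain v where v: "v > 0" "(\<tau> \<longlongrightarrow> v) F" "(\<kappa> \<longlongrightarrow> 0) F" using lim[OF F] by blast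
    have "((\<lambda>y. P y - \<kappa> y / \<tau> y) \<longlongrightarrow> a * \<gamma> * v powr (- \<gamma> - 1) - 0 / v) F"
      unfolding P_def using v by (intro tendsto_intros) auto
    then have "(\<alpha> \<longlongrightarrow> a * \<gamma> * v powr (- \<gamma> - 1)) F"
      unfolding \<alpha>_eq[symmetric] by simp
    then have "((\<lambda>y. T y \<mu>) \<longlongrightarrow> lag_to_eul v 0 (a * \<gamma> * v powr (- \<gamma> - 1)) 1) F"
      if "\<mu> \<in> evans_region" for \<mu>
      unfolding T_def using v that by (intro tendsto_lag_to_eul) (auto simp: evans_region_def)
    moreover have "det (lag_to_eul v 0 (a * \<gamma> * v powr (- \<gamma> - 1)) 1) \<noteq> 0"
      using v(1) by (simp add: det_lag_to_eul)
    ultimately show ?thesis by blast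
  qed
  obtain T\<^sub>p where Tp: "det T\<^sub>p \<noteq> 0" "\<And>\<mu>. \<mu> \<in> evans_region \<Longrightarrow> ((\<lambda>y. T y \<mu>) \<longlongrightarrow> T\<^sub>p) at_top"
    using limit by blast
  obtain T\<^sub>m where Tm: "det T\<^sub>m \<noteq> 0" "\<And>\<mu>. \<mu> \<in> evans_region \<Longrightarrow> ((\<lambda>y. T y \<mu>) \<longlongrightarrow> T\<^sub>m) at_bot"
    using limit by blast
  obtain c where c: "c \<noteq> 0" "\<And>\<mu>. \<mu> \<in> evans_region \<Longrightarrow> D\<^sub>p\<^sub>L \<mu> = c * det (T 0 \<mu>) * D\<^sub>L \<mu>"
    using evans_function_conjugate[OF assms(5)[folded \<tau>_def, unfolded w] assms(4) T' Tp(2,1) Tm(2,1)]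
    by blast
  \<comment> \<open>\<open>det (T 0 \<mu>)\<close> is free of \<mu>, so its product with
    \<open>c\<close> is the required constant.\<close>
  have "c * (- 1 / (complex_of_real (\<tau> 0))\<^sup>2) \<noteq> 0"
    using c(1) pos[of 0] by simp
  then show ?thesis
    using c(2) unfolding T_def det_lag_to_eul by blast
qed

end
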